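(* Let $K$ be the middle third Cantor set and $\gamma=\frac{\log 2}{\log 3}$. For every real $\alpha\ge2$, $$\dim(E(\alpha)\cap K)\ge\gamma/\alpha .$$ In particular, for every $\alpha>2$, $$\mathcal{H}^{\gamma/\alpha}(E(\alpha)\cap K)=\infty .$$
   Context: $\dim$ denotes Hausdorff dimension and $\mathcal{H}^s$ denotes $s$-dimensional Hausdorff measure. $K\subset[0,1]$ is the standard middle third Cantor set. For $\tau>0$, $W(\tau)$ is the set of real numbers $x$ such that $|x-p/q|<q^{-\tau}$ for infinitely many $(p,q)\in\mathbb{Z}\times\mathbb{N}$. The exact order of a real number $x$ is $\tau(x):=\sup\{\tau : x\in W(\tau)\}$. For $\alpha\ge2$, $E(\alpha):=\{x\in\mathbb{R} : \tau(x)=\alpha\}$. *)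

theory Defs
  imports "HOL-Analysis.Analysis"
begin

text \<open>The convention is that the empty set contributes \<open>0\<close> and, for \<open>s = 0\<close>, a nonempty set
  contributes \<open>1\<close> (so that \<open>s = 0\<close> gives counting measure); \<open>powr\<close> alone would give \<open>0 powr 0 = 0\<close>.\<close>

definition diam_power :: "real \<Rightarrow> 'a::metric_space set \<Rightarrow> ennreal" where
  "diam_power s U = (if U = {} then 0 else if s = 0 then 1 else ennreal (diameter U powr s))"

text \<open>Boundedness is required because \<^const>\<open>diameter\<close> is only meaningful for bounded sets.
  Countable covers are sequences; finite covers are padded with empty sets.\<close>

definition delta_covers :: "real \<Rightarrow> 'a::metric_space set \<Rightarrow> (nat \<Rightarrow> 'a set) set" where
  "delta_covers \<delta> A =
     {U. (\<forall>i. bounded (U i) \<and> diameter (U i) \<le> \<delta>) \<and> A \<subseteq> (\<Union>i. U i)}"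

definition hausdorff_premeasure :: "real \<Rightarrow> real \<Rightarrow> 'a::metric_space set \<Rightarrow> ennreal" where
  "hausdorff_premeasure \<delta> s A = (INF U \<in> delta_covers \<delta> A. \<Sum>i. diam_power s (U i))"

definition hausdorff_measure :: "real \<Rightarrow> 'a::metric_space set \<Rightarrow> ennreal" where
  "hausdorff_measure s A = (SUP \<delta> \<in> {0<..}. hausdorff_premeasure \<delta> s A)"

definition hausdorff_dim :: "'a::metric_space set \<Rightarrow> ereal" where
  "hausdorff_dim A = Inf {ereal s |s. 0 \<le> s \<and> hausdorff_measure s A = 0}"

primrec cantor_stage :: "nat \<Rightarrow> real set" where
  "cantor_stage 0 = {0..1}"
| "cantor_stage (Suc n) = (\<lambda>x. x / 3) ` cantor_stage n \<union> (\<lambda>x. (x + 2) / 3) ` cantor_stage n"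

definition cantor_set :: "real set" where
  "cantor_set = (\<Inter>n. cantor_stage n)"

text \<open>Pairs \<open>(p, q)\<close> are counted, not fractions: they need not be coprime, so a rational number lies
  in \<open>W \<tau>\<close> for every \<open>\<tau>\<close>.\<close>

definition W :: "real \<Rightarrow> real set" where
  "W \<tau> = {x. infinite {(p :: int, q :: nat).
     0 < q \<and> \<bar>x - real_of_int p / real q\<bar> < real q powr (- \<tau>)}}"

text \<open>Extended real valued, since the supremum may be infinite.\<close>

definition exact_order :: "real \<Rightarrow> ereal" where
  "exact_order x = Sup {ereal \<tau> |\<tau>. 0 < \<tau> \<and> x \<in> W \<tau>}"

definition E :: "real \<Rightarrow> real set" where
  "E \<alpha> = {x. exact_order x = ereal \<alpha>}"

end

theory Submission
  imports Defs "HOL-Probability.Probability" "HOL-Real_Asymp.Real_Asymp"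
begin

text \<open>Choose random ternary digits in \<open>{0, 2}\<close>, except that the digits in very sparse blocks
  \<open>[n\<^sub>k, m\<^sub>k)\<close> are forced to be \<open>0\<close>, where \<open>m\<^sub>k / n\<^sub>k\<close> increases to \<open>\<alpha>\<close>. The blocks give approximations
  with denominators \<open>3 ^ n\<^sub>k\<close> of every order below \<open>\<alpha>\<close>. Since \<open>m\<^sub>k\<close> falls slightly short of \<open>\<alpha> n\<^sub>k\<close>,
  the law of the random point gives an interval of length \<open>d\<close> mass \<open>o(d powr (\<gamma> / \<alpha>))\<close>, so the mass
  distribution principle yields infinite measure of any set carrying the law.

  It remains to see that almost surely no other rational approximates better than to order \<open>\<alpha>\<close>. For
  denominators \<open>q\<close> near \<open>3 ^ u\<close> and order \<open>\<tau> > \<alpha>\<close>, the event that such an approximation exists has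
  probability exponentially small in \<open>u\<close>. If the digits around \<open>2u, \<dots>, \<tau>u\<close> are mostly free, then
  this follows from the spacing of the rationals. Otherwise a block starts there at some \<open>n\<close>, the point is
  essentially \<open>P / 3 ^ n\<close>, and the small remainder \<open>r = p 3 ^ n - P q\<close> makes \<open>P\<close> 3-adically close to a
  rational of small height; now the last digits of \<open>P\<close> determine the earlier ones.\<close>

subsection \<open>Coin tossing\<close>

definition coin_space :: "(nat \<Rightarrow> bool) measure" where
  "coin_space = PiM UNIV (\<lambda>_. measure_pmf (bernoulli_pmf (1 / 2)))"

interpretation coin: product_prob_space "\<lambda>_::nat. measure_pmf (bernoulli_pmf (1 / 2))" UNIV
  by (simp add: product_prob_space.intro product_prob_space_axioms_def product_sigma_finite_def
      prob_space_measure_pmf measure_pmf.sigma_finite_measure_axioms)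

lemma prob_space_coin_space: "prob_space coin_space"
  unfolding coin_space_def by (rule coin.P.prob_space_axioms)

lemma space_coin_space [simp]: "space coin_space = UNIV"
  by (simp add: coin_space_def space_PiM)

lemma measurable_coin [measurable]: "(\<lambda>\<omega>. \<omega> i) \<in> measurable coin_space (count_space UNIV)"
proof -
  have "(\<lambda>\<omega>. \<omega> i) \<in> measurable coin_space (measure_pmf (bernoulli_pmf (1 / 2)))"
    unfolding coin_space_def by measurable
  then show ?thesis by simp
qed

lemma prob_cylinder:
  assumes "finite J"
  shows "measure coin_space {\<omega>. \<forall>i\<in>J. \<omega> i = f i} = (1 / 2) ^ card J"
proof -
  have pt: "emeasure (measure_pmf (bernoulli_pmf (1 / 2))) {b} = ennreal (1/2)" for b
    by (cases b) (simp_all add: emeasure_pmf_single)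
  have "emeasure coin_space {\<omega>. \<forall>i\<in>J. \<omega> i = f i} = (\<Prod>i\<in>J. ennreal (1 / 2))"
    using coin.emeasure_PiM_Collect[OF _ assms, of "\<lambda>i. {f i}"]
    by (simp only: coin_space_def [symmetric] pt) simp
  also have "\<dots> = ennreal ((1 / 2) ^ card J)"
    by (simp only: prod_constant) (rule ennreal_power, simp)
  finally have "emeasure coin_space {\<omega>. \<forall>i\<in>J. \<omega> i = f i} = ennreal ((1 / 2) ^ card J)" .
  then show ?thesis by (simp add: measure_def)
qed

lemma sets_cylinder [measurable]: 
  assumes "finite J"
  shows "{\<omega>. \<forall>i\<in>J. \<omega> i = f i} \<in> sets coin_space"
proof -
  have "{\<omega> \<in> space coin_space. \<forall>i\<in>J. \<omega> i = f i} \<in> sets coin_space"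
    using assms by measurable
  then show ?thesis by simp
qed

text \<open>On \<open>B\<close> the bits in \<open>J\<^sub>1\<close> show at most
  \<open>2 ^ card J\<^sub>1\<close> patterns, and each extends to only one pattern on
  \<open>J\<^sub>2\<close>. So \<open>B\<close> is covered by that many cylinders over both sets of
  positions. The digit estimates below are instances of this count.\<close>

lemma prob_le_of_determined:
  assumes J: "finite J\<^sub>1" "finite J\<^sub>2" "J\<^sub>1 \<inter> J\<^sub>2 = {}"
    and det: "\<And>\<omega> \<omega>' i. \<omega> \<in> B \<Longrightarrow> \<omega>' \<in> B \<Longrightarrow> (\<And>j. j \<in> J\<^sub>1 \<Longrightarrow> \<omega> j = \<omega>' j) \<Longrightarrow> i \<in> J\<^sub>2 \<Longrightarrow> \<omega> i = \<omega>' i"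
  shows "measure coin_space B \<le> (1 / 2) ^ card J\<^sub>2"
proof -
  interpret prob_space coin_space by (rule prob_space_coin_space)
  define J where "J = J\<^sub>1 \<union> J\<^sub>2"
  have J': "finite J" "card J = card J\<^sub>1 + card J\<^sub>2"
    using J by (auto simp: J_def card_Un_disjoint)
  define S where "S = (\<lambda>\<omega>. {i\<in>J. \<omega> i}) ` B"
  have finS: "finite S"
    by (rule finite_subset[of _ "Pow J"]) (auto simp: S_def J')
  have "inj_on (\<lambda>A. A \<inter> J\<^sub>1) S"
  proof (rule inj_onI)
    fix A A' assume "A \<in> S" "A' \<in> S" and eq: "A \<inter> J\<^sub>1 = A' \<inter> J\<^sub>1"
    then obtain \<omega> \<omega>' where w: "\<omega> \<in> B" "\<omega>' \<in> B" "A = {i\<in>J. \<omega> i}" "A' = {i\<in>J. \<omega>' i}"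
      by (auto simp: S_def)
    have 1: "\<omega> j = \<omega>' j" if "j \<in> J\<^sub>1" for j using eq that w by (auto simp: J_def)
    have 2: "\<omega> j = \<omega>' j" if "j \<in> J\<^sub>2" for j using det[OF w(1,2) 1 that] .
    show "A = A'" using 1 2 w by (auto simp: J_def)
  qed
  then have "card S \<le> card (Pow J\<^sub>1)"
    by (rule card_inj_on_le) (auto simp: J)
  then have "real (card S) \<le> real (2 ^ card J\<^sub>1)" by (simp only: card_Pow J of_nat_le_iff)
  then have cardS: "real (card S) \<le> 2 ^ card J\<^sub>1" by simp
  let ?C = "\<lambda>A. {\<omega>. \<forall>i\<in>J. \<omega> i = (i \<in> A)}"
  have "B \<subseteq> (\<Union>A\<in>S. ?C A)" by (auto simp: S_def)
  then have "measure coin_space B \<le> measure coin_space (\<Union>A\<in>S. ?C A)"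
    by (rule finite_measure_mono) (use finS J' in \<open>auto intro!: sets.finite_UN sets_cylinder\<close>)
  also have "\<dots> \<le> (\<Sum>A\<in>S. measure coin_space (?C A))"
    by (rule finite_measure_subadditive_finite) (use finS J' in \<open>auto intro!: sets_cylinder\<close>)
  also have "\<dots> = real (card S) * (1 / 2) ^ card J"
    by (subst prob_cylinder) (auto simp: J')
  also have "\<dots> \<le> 2 ^ card J\<^sub>1 * (1 / 2) ^ card J"
    using cardS by (rule mult_right_mono) simp
  also have "\<dots> = (1 / 2) ^ card J\<^sub>2"
    by (simp add: J' power_add power_divide)
  finally show ?thesis .
qed

subsection \<open>Ternary expansions\<close>

text \<open>The bit \<open>b i\<close> stands for the ternary digit \<open>0\<close> or \<open>2\<close>; positions are counted from \<open>0\<close>.\<close>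

primrec ternary_num :: "(nat \<Rightarrow> bool) \<Rightarrow> nat \<Rightarrow> int" where
  "ternary_num b 0 = 0"
| "ternary_num b (Suc n) = 3 * ternary_num b n + 2 * of_bool (b n)"

definition cantor_point :: "(nat \<Rightarrow> bool) \<Rightarrow> real" where
  "cantor_point b = (\<Sum>i. 2 * of_bool (b i) / 3 ^ Suc i)"

lemma sums_two_thirds: "(\<lambda>i. 2 / 3 ^ Suc i) sums (1::real)"
  using sums_mult[OF geometric_sums[of "1/3::real"], of "2/3"]
  by (simp add: field_simps power_divide)

lemma summable_cantor_point: "summable (\<lambda>i. 2 * of_bool (b i) / 3 ^ Suc i :: real)"
  by (rule summable_comparison_test'[OF sums_summable[OF sums_two_thirds]])
    (auto simp: of_bool_def)

lemma ternary_num_conv_sum: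
  "real_of_int (ternary_num b n) / 3 ^ n = (\<Sum>i<n. 2 * of_bool (b i) / 3 ^ Suc i)"
proof (induction n)
  case (Suc n)
  then show ?case by (simp add: field_simps of_bool_def split: if_splits)
qed simp

lemma cantor_point_ge: "real_of_int (ternary_num b n) / 3 ^ n \<le> cantor_point b"
  unfolding ternary_num_conv_sum cantor_point_def
  by (rule sum_le_suminf[OF summable_cantor_point]) auto

text \<open>The tail is largest when every remaining digit is \<open>2\<close>; hence the comparison
  with the all-\<open>2\<close> expansion of \<open>1\<close>.\<close>

lemma cantor_point_le: "cantor_point b \<le> (real_of_int (ternary_num b n) + 1) / 3 ^ n"
proof -
  have geo: "(\<Sum>i<n. 2 / 3 ^ Suc i) = (1::real) - 1 / 3 ^ n"
    by (induction n) (auto simp: field_simps)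
  have *: "summable (\<lambda>i. 2 / 3 ^ Suc i - 2 * of_bool (b i) / 3 ^ Suc i :: real)"
    by (intro summable_diff summable_cantor_point sums_summable[OF sums_two_thirds])
  have "(\<Sum>i<n. 2 / 3 ^ Suc i - 2 * of_bool (b i) / 3 ^ Suc i :: real)
     \<le> (\<Sum>i. 2 / 3 ^ Suc i - 2 * of_bool (b i) / 3 ^ Suc i)"
    by (rule sum_le_suminf[OF *]) (auto simp: of_bool_def)
  also have "\<dots> = 1 - cantor_point b"
    unfolding cantor_point_def sums_unique[OF sums_two_thirds]
    by (intro suminf_diff [symmetric] summable_cantor_point sums_summable[OF sums_two_thirds])
  finally show ?thesis
    unfolding sum_subtractf geo ternary_num_conv_sum [symmetric] by (simp add: add_divide_distrib)
qed

section \<open>Recovering digits from distances and from residues\<close>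

lemma ternary_num_cong: "(\<And>i. i < n \<Longrightarrow> b i = b' i) \<Longrightarrow> ternary_num b n = ternary_num b' n"
  by (induction n) auto

lemma abs_diff_cantor_point_le:
  assumes "\<And>i. i < n \<Longrightarrow> b i = b' i"
  shows "\<bar>cantor_point b - cantor_point b'\<bar> \<le> 1 / 3 ^ n"
  using cantor_point_ge[of b n] cantor_point_le[of b n] cantor_point_ge[of b' n]
    cantor_point_le[of b' n] ternary_num_cong[of n b b'] assms
  by (auto simp: add_divide_distrib)

text \<open>The digit \<open>1\<close> is missing: at the first position \<open>i\<close> of
  disagreement the points lie in triadic intervals separated by a gap of length
  \<open>1 / 3 ^ Suc i\<close>, which is at least \<open>1 / 3 ^ n\<close>.\<close>

lemma eq_of_abs_diff_cantor_point_less: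
  assumes "\<bar>cantor_point b - cantor_point b'\<bar> < 1 / 3 ^ n" "i < n"
  shows "b i = b' i"
  using assms(2)
proof (induction i rule: less_induct)
  case (less i)
  have eq: "ternary_num b i = ternary_num b' i"
    using less by (intro ternary_num_cong) auto
  have "(1 / 3 ^ n :: real) \<le> 1 / 3 ^ Suc i"
    by (intro divide_left_mono power_increasing) (use less.prems in auto)
  then have "\<bar>cantor_point b - cantor_point b'\<bar> < 1 / 3 ^ Suc i" using assms(1) by linarith
  then show ?case
    using cantor_point_ge[of b "Suc i"] cantor_point_le[of b "Suc i"]
      cantor_point_ge[of b' "Suc i"] cantor_point_le[of b' "Suc i"] eq
    by (cases "b i"; cases "b' i") (auto simp: add_divide_distrib)
qed

lemma ternary_num_append_zeros:
  assumes "n \<le> m" "\<And>i. n \<le> i \<Longrightarrow> i < m \<Longrightarrow> \<not> b i"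
  shows "ternary_num b m = 3 ^ (m - n) * ternary_num b n"
  using assms
proof (induction m rule: dec_induct)
  case (step m)
  then show ?case by (simp add: Suc_diff_le)
qed simp

text \<open>The zeros make the truncations at \<open>n\<close> and at \<open>m\<close> the same
  number, so the short one inherits the error of the long one.\<close>

lemma abs_cantor_point_diff_zeros:
  assumes "n \<le> m" "\<And>i. n \<le> i \<Longrightarrow> i < m \<Longrightarrow> \<not> b i"
  shows "\<bar>cantor_point b - real_of_int (ternary_num b n) / 3 ^ n\<bar> \<le> 1 / 3 ^ m"
proof -
  have "real_of_int (ternary_num b m) / 3 ^ m = real_of_int (ternary_num b n) / 3 ^ n"
    using assms(1) by (simp add: ternary_num_append_zeros[OF assms] field_simps flip: power_add)
  then show ?thesis
    using cantor_point_ge[of b m] cantor_point_le[of b m] by (simp add: add_divide_distrib abs_le_iff)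
qed

lemma dvd_ternary_num_diff:
  assumes "\<And>i. k \<le> i \<Longrightarrow> i < k + j \<Longrightarrow> b i = b' i"
  shows "3 ^ j dvd ternary_num b (k + j) - ternary_num b' (k + j)"
  using assms
proof (induction j)
  case (Suc j)
  have "3 * 3 ^ j dvd 3 * (ternary_num b (k + j) - ternary_num b' (k + j))"
    using Suc by (intro mult_dvd_mono) auto
  then show ?case using Suc.prems by (simp add: algebra_simps)
qed simp

text \<open>Digits \<open>0\<close> and \<open>2\<close> differ modulo \<open>3\<close>, so the
  residue reveals the last digit; removing it and a factor \<open>3\<close> leaves the same problem
  with one digit less.\<close>

lemma eq_of_dvd_ternary_num_diff:
  assumes "3 ^ j dvd ternary_num b (k + j) - ternary_num b' (k + j)" "k \<le> i" "i < k + j"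
  shows "b i = b' i"
  using assms
proof (induction j arbitrary: i)
  case (Suc j)
  let ?N = "ternary_num b (k + j) - ternary_num b' (k + j)"
  have d: "3 * 3 ^ j dvd 3 * ?N + 2 * (of_bool (b (k + j)) - of_bool (b' (k + j)))"
    using Suc.prems(1) by (simp add: algebra_simps)
  then have "3 dvd 3 * ?N + 2 * (of_bool (b (k + j)) - of_bool (b' (k + j)))"
    by (rule dvd_mult_left)
  then have "3 dvd 2 * (of_bool (b (k + j)) - of_bool (b' (k + j)) :: int)"
    by (simp add: dvd_add_right_iff)
  then have last: "b (k + j) = b' (k + j)"
    by (cases "b (k + j)"; cases "b' (k + j)") auto
  then have "3 * 3 ^ j dvd 3 * ?N" using d by simp
  then have "3 ^ j dvd ?N" unfolding dvd_mult_cancel_left by simp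
  with Suc.IH last Suc.prems show ?case by (cases "i = k + j") auto
qed simp

lemma cantor_point_Suc:
  "cantor_point b = (2 * of_bool (b 0) + cantor_point (\<lambda>i. b (Suc i))) / 3"
  using suminf_split_initial_segment[OF summable_cantor_point, of b 1]
    suminf_mult[OF summable_cantor_point, of "1/3" "\<lambda>i. b (Suc i)"]
  by (simp add: cantor_point_def add_divide_distrib)

lemma cantor_point_in_cantor_set: "cantor_point b \<in> cantor_set"
proof -
  have "cantor_point b \<in> cantor_stage n" for n
  proof (induction n arbitrary: b)
    case 0
    show ?case using cantor_point_ge[of b 0] cantor_point_le[of b 0] by simp
  next
    case (Suc n)
    show ?case
    proof (cases "b 0")
      case True
      then have "cantor_point b = (cantor_point (\<lambda>i. b (Suc i)) + 2) / 3"
        by (subst cantor_point_Suc) (simp add: add.commute)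
      then show ?thesis using Suc[of "\<lambda>i. b (Suc i)"] by simp
    next
      case False
      then have "cantor_point b = cantor_point (\<lambda>i. b (Suc i)) / 3"
        by (subst cantor_point_Suc) simp
      then show ?thesis using Suc[of "\<lambda>i. b (Suc i)"] by simp
    qed
  qed
  then show ?thesis by (simp add: cantor_set_def)
qed

subsection \<open>Mass distribution principle\<close>

lemma diam_power_antimono:
  assumes "0 \<le> t" "t \<le> s" "0 < s" "bounded U" "diameter U \<le> 1"
  shows "diam_power s U \<le> diam_power t U"
proof -
  have "diameter U powr s \<le> 1"
    using powr_mono2[of s "diameter U" 1] assms diameter_ge_0 by auto
  moreover have "diameter U powr s \<le> diameter U powr t"
    using powr_mono'[of t s "diameter U"] assms diameter_ge_0 by auto
  ultimately show ?thesis
    using assms by (auto simp: diam_power_def ennreal_leI ennreal_le_1)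
qed

lemma hausdorff_premeasure_antimono:
  assumes "\<delta> \<le> \<delta>'"
  shows "hausdorff_premeasure \<delta>' s A \<le> hausdorff_premeasure \<delta> s A"
  unfolding hausdorff_premeasure_def
  by (rule INF_superset_mono) (use assms in \<open>auto simp: delta_covers_def intro: order_trans\<close>)

text \<open>If the \<open>t\<close>-dimensional measure vanished for some \<open>t < s\<close>,
  comparing the two powers of the diameters over fine covers would make the
  \<open>s\<close>-dimensional measure vanish too.\<close>

lemma hausdorff_dim_ge:
  assumes "0 < s" "hausdorff_measure s A = \<infinity>"
  shows "ereal s \<le> hausdorff_dim A"
  unfolding hausdorff_dim_def
proof (rule Inf_greatest, clarsimp)
  fix t assume t: "0 \<le> t" "hausdorff_measure t A = 0"
  show "s \<le> t"
  proof (rule ccontr)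
    assume "\<not> s \<le> t"
    have "hausdorff_premeasure \<delta> s A = 0" if "0 < \<delta>" for \<delta>
    proof -
      \<comment> \<open>For diameters up to \<open>1\<close> the power decreases in the
        exponent.\<close>
      define \<delta>' where "\<delta>' = min \<delta> 1"
      have \<delta>': "0 < \<delta>'" "\<delta>' \<le> 1" "\<delta>' \<le> \<delta>" using that by (auto simp: \<delta>'_def)
      have "hausdorff_premeasure \<delta> s A \<le> hausdorff_premeasure \<delta>' s A"
        by (rule hausdorff_premeasure_antimono) fact
      also have "\<dots> \<le> hausdorff_premeasure \<delta>' t A"
        unfolding hausdorff_premeasure_def
      proof (rule INF_mono, rule bexI)
        fix U assume U: "U \<in> delta_covers \<delta>' A"
        then show "(\<Sum>i. diam_power s (U i)) \<le> (\<Sum>i. diam_power t (U i))"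
          using t \<open>\<not> s \<le> t\<close> \<open>0 < s\<close> \<delta>'
          by (intro suminf_le summableI diam_power_antimono)
            (auto simp: delta_covers_def intro: order_trans)
      qed
      also have "\<dots> \<le> hausdorff_measure t A"
        unfolding hausdorff_measure_def using \<delta>' by (intro SUP_upper) auto
      finally show ?thesis using t by simp
    qed
    then have "hausdorff_measure s A = 0"
      unfolding hausdorff_measure_def by simp
    with assms show False by simp
  qed
qed

text \<open>The probabilities that \<open>X\<close> falls into the closed members of a fine cover
  sum to at least \<open>1\<close>, and \<open>small\<close> bounds \<open>N\<close> times each by a
  power of the diameter. So the measure is at least every \<open>N\<close>.\<close>

lemma hausdorff_measure_eq_top_of_mass:
  fixes X :: "'a \<Rightarrow> 'b::metric_space"
  assumes "prob_space M" and [measurable]: "X \<in> borel_measurable M" and "0 < s"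
    and AE: "AE \<omega> in M. X \<omega> \<in> A"
    and small: "\<And>N. 0 < N \<Longrightarrow> \<exists>\<delta>>0. \<forall>V. closed V \<longrightarrow> bounded V \<longrightarrow> diameter V \<le> \<delta> \<longrightarrow>
      N * measure M {\<omega> \<in> space M. X \<omega> \<in> V} \<le> diameter V powr s"
  shows "hausdorff_measure s A = \<infinity>"
proof -
  interpret prob_space M by fact
  have large: "ennreal N \<le> hausdorff_measure s A" if N: "0 < N" for N :: real
  proof -
    obtain \<delta> where \<delta>: "0 < \<delta>" and \<delta>_small: "\<And>V. closed V \<Longrightarrow> bounded V \<Longrightarrow> diameter V \<le> \<delta> \<Longrightarrow>
      N * measure M {\<omega> \<in> space M. X \<omega> \<in> V} \<le> diameter V powr s"
      using small[OF N] by blast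
    have "ennreal N \<le> hausdorff_premeasure \<delta> s A"
      unfolding hausdorff_premeasure_def
    proof (rule INF_greatest)
      fix U assume U: "U \<in> delta_covers \<delta> A"
      \<comment> \<open>Members of a cover may fail to be measurable; closures are Borel and have
        the same diameter.\<close>
      define C where "C i = {\<omega> \<in> space M. X \<omega> \<in> closure (U i)}" for i
      have C [measurable]: "C i \<in> sets M" for i
        using measurable_sets[OF assms(2), of "closure (U i)"]
        by (simp add: C_def vimage_def Int_def conj_commute)
      have "AE \<omega> in M. \<omega> \<in> (\<Union>i. C i)"
        using AE AE_space
      proof eventually_elim
        case (elim \<omega>)
        then obtain i where "X \<omega> \<in> U i" using U by (auto simp: delta_covers_def)
        then show ?case using elim closure_subset by (auto simp: C_def)
      qed
      then have "emeasure M (\<Union>i. C i) = 1"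
        by (subst emeasure_eq_1_AE) auto
      then have "1 \<le> (\<Sum>i. emeasure M (C i))"
        using emeasure_subadditive_countably[of C M] C by (simp add: image_subset_iff)
      then have "ennreal N \<le> ennreal N * (\<Sum>i. emeasure M (C i))"
        by (metis mult.right_neutral mult_left_mono zero_le)
      also have "\<dots> = (\<Sum>i. ennreal N * emeasure M (C i))" by (rule ennreal_suminf_cmult [symmetric])
      also have "\<dots> \<le> (\<Sum>i. diam_power s (U i))"
      proof (intro suminf_le summableI)
        fix i
        show "ennreal N * emeasure M (C i) \<le> diam_power s (U i)"
        proof (cases "U i = {}")
          case True
          then show ?thesis by (simp add: C_def)
        next
          case False
          have b: "bounded (U i)" "diameter (U i) \<le> \<delta>" using U by (auto simp: delta_covers_def)
          have "N * measure M (C i) \<le> diameter (closure (U i)) powr s"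
            unfolding C_def by (rule \<delta>_small) (use b in \<open>auto simp: diameter_closure\<close>)
          then show ?thesis
            using False \<open>0 < s\<close> N b
            by (simp add: diam_power_def emeasure_eq_measure diameter_closure ennreal_leI
                flip: ennreal_mult)
        qed
      qed
      finally show "ennreal N \<le> (\<Sum>i. diam_power s (U i))" .
    qed
    also have "\<dots> \<le> hausdorff_measure s A"
      unfolding hausdorff_measure_def using \<delta> by (intro SUP_upper) auto
    finally show ?thesis .
  qed
  show ?thesis
  proof (rule ccontr)
    assume "\<not> ?thesis"
    then obtain r where r: "0 \<le> r" "hausdorff_measure s A = ennreal r"
      by (cases "hausdorff_measure s A") auto
    then show False using large[of "r + 1"] by simp
  qed
qed

subsection \<open>Rational approximation\<close>

lemma abs_diff_fractions_ge:
  fixes p p' :: int and q q' :: nat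
  assumes "0 < q" "0 < q'" "real_of_int p / real q \<noteq> real_of_int p' / real q'"
  shows "1 / (real q * real q') \<le> \<bar>real_of_int p / real q - real_of_int p' / real q'\<bar>"
proof -
  have eq: "real_of_int p / real q - real_of_int p' / real q'
      = real_of_int (p * int q' - p' * int q) / (real q * real q')"
    using assms by (simp add: field_simps)
  have "p * int q' - p' * int q \<noteq> 0"
  proof
    assume "p * int q' - p' * int q = 0"
    then have "real_of_int p / real q - real_of_int p' / real q' = 0" by (simp add: eq)
    then show False using assms by simp
  qed
  then have "1 \<le> \<bar>real_of_int (p * int q' - p' * int q)\<bar>" by linarith
  then show ?thesis unfolding eq using assms by (simp add: abs_div divide_right_mono)
qed

text \<open>Bounded denominators leave only finitely many numerators, so infinitely many pairs force
  arbitrarily large denominators; \<open>u\<close> is the triadic scale of one of them.\<close>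

lemma mem_W_imp_large_denominator:
  assumes "x \<in> W \<tau>" "0 < \<tau>"
  obtains u q p where "U \<le> u" "3 ^ u \<le> q" "q < 3 ^ Suc u"
    "\<bar>x - real_of_int p / real q\<bar> < real q powr - \<tau>"
proof -
  let ?S = "{(p :: int, q :: nat). 0 < q \<and> \<bar>x - real_of_int p / real q\<bar> < real q powr (- \<tau>)}"
  define N :: nat where "N = 3 ^ U"
  \<comment> \<open>Bounds the numerators of all pairs with \<open>q \<le> N\<close>, since
    \<open>p / q\<close> is within \<open>1\<close> of \<open>x\<close>.\<close>
  define B where "B = \<lceil>real N * (\<bar>x\<bar> + 1)\<rceil>"
  have "\<not> ?S \<subseteq> {-B..B} \<times> {..N}"
    using assms(1) finite_subset[of ?S "{-B..B} \<times> {..N}"] by (auto simp: W_def)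
  then obtain p q where pq: "0 < q" "\<bar>x - real_of_int p / real q\<bar> < real q powr (- \<tau>)"
    and out: "(p, q) \<notin> {-B..B} \<times> {..N}"
    by blast
  have "N < q"
  proof (rule ccontr)
    assume "\<not> N < q"
    have "real q powr (- \<tau>) \<le> 1 powr (- \<tau>)"
      using pq(1) assms(2) by (intro powr_mono2') auto
    then have "real q powr (- \<tau>) \<le> 1" by simp
    then have "\<bar>real_of_int p / real q\<bar> \<le> \<bar>x\<bar> + 1" using pq(2) by linarith
    then have "\<bar>real_of_int p\<bar> \<le> real q * (\<bar>x\<bar> + 1)"
      using pq(1) by (simp add: abs_div field_simps)
    also have "\<dots> \<le> real N * (\<bar>x\<bar> + 1)" using \<open>\<not> N < q\<close> by (intro mult_right_mono) auto
    finally have "\<bar>p\<bar> \<le> B" unfolding B_def by linarith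
    then show False using out \<open>\<not> N < q\<close> by auto
  qed
  obtain u where u: "3 ^ u \<le> q" "q < 3 ^ Suc u"
    using ex_power_ivl1[of 3 q] pq(1) by auto
  have "(3::nat) ^ U < 3 ^ Suc u" using u \<open>N < q\<close> by (simp add: N_def)
  then have "U \<le> u" by (subst (asm) power_strict_increasing_iff) auto
  then show thesis using that u pq by blast
qed

subsection \<open>Digits with forced zero blocks\<close>

locale zero_blocks =
  fixes \<alpha> :: real
  assumes alpha_ge_2: "2 \<le> \<alpha>"
begin

text \<open>One factor \<open>k + 2\<close> is spent on the slack \<open>1 / (k + 2)\<close> in the
  length of the next block, the other makes the surplus of free digits unbounded;
  \<open>nat \<lceil>\<alpha>\<rceil>\<close> bridges the passage from the start to the end of a
  block.\<close>

primrec block_start :: "nat \<Rightarrow> nat" where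
  "block_start 0 = 1"
| "block_start (Suc k) = nat \<lceil>\<alpha>\<rceil> * (k + 2)\<^sup>2 * block_start k"

definition block_end :: "nat \<Rightarrow> nat" where
  "block_end k = nat \<lfloor>(\<alpha> - 1 / (k + 1)) * block_start k\<rfloor>"

definition free :: "nat \<Rightarrow> bool" where
  "free i \<longleftrightarrow> (\<forall>k. \<not> (block_start k \<le> i \<and> i < block_end k))"

definition bits :: "(nat \<Rightarrow> bool) \<Rightarrow> nat \<Rightarrow> bool" where
  "bits \<omega> i \<longleftrightarrow> \<omega> i \<and> free i"

definition point :: "(nat \<Rightarrow> bool) \<Rightarrow> real" where
  "point \<omega> = cantor_point (bits \<omega>)"

declare block_start.simps(2) [simp del]

lemma block_start_pos: "1 \<le> block_start k"
  using alpha_ge_2 by (induction k) (auto simp: Suc_le_eq block_start.simps(2))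

lemma block_start_Suc_ge: "\<alpha> * (real k + 2)\<^sup>2 * real (block_start k) \<le> real (block_start (Suc k))"
proof -
  have "\<alpha> \<le> real (nat \<lceil>\<alpha>\<rceil>)" using alpha_ge_2 by linarith
  then have "\<alpha> * ((real k + 2)\<^sup>2 * real (block_start k)) \<le>
      real (nat \<lceil>\<alpha>\<rceil>) * ((real k + 2)\<^sup>2 * real (block_start k))"
    by (rule mult_right_mono) simp
  then show ?thesis by (simp add: mult.assoc add.commute block_start.simps(2))
qed

lemma block_end_le: "real (block_end k) \<le> (\<alpha> - 1 / (real k + 1)) * real (block_start k)"
  and block_end_gt: "(\<alpha> - 1 / (real k + 1)) * real (block_start k) - 1 < real (block_end k)"
  and block_start_le_end: "block_start k \<le> block_end k"
proof -
  have "1 / (real k + 1) \<le> 1" by (simp add: field_simps)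
  then have "1 * real (block_start k) \<le> (\<alpha> - 1 / (real k + 1)) * real (block_start k)"
    using alpha_ge_2 by (intro mult_right_mono) linarith+
  then have *: "real (block_start k) \<le> (\<alpha> - 1 / (real k + 1)) * real (block_start k)" by simp
  have **: "block_end k = nat \<lfloor>(\<alpha> - 1 / (real k + 1)) * real (block_start k)\<rfloor>"
    by (simp add: block_end_def)
  from * show "block_start k \<le> block_end k" unfolding ** by linarith
  from * show "real (block_end k) \<le> (\<alpha> - 1 / (real k + 1)) * real (block_start k)"
    unfolding ** by linarith
  from * show "(\<alpha> - 1 / (real k + 1)) * real (block_start k) - 1 < real (block_end k)"
    unfolding ** by linarith
qed

lemma block_end_le_alpha_mult: "real (block_end k) \<le> \<alpha> * real (block_start k)"
proof -
  have "(\<alpha> - 1 / (real k + 1)) * real (block_start k) \<le> \<alpha> * real (block_start k)"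
    by (rule mult_right_mono) auto
  then show ?thesis using block_end_le[of k] by linarith
qed

lemma square_mult_block_end_le: "(real k + 2)\<^sup>2 * real (block_end k) \<le> real (block_start (Suc k))"
proof -
  have "(real k + 2)\<^sup>2 * real (block_end k) \<le> (real k + 2)\<^sup>2 * (\<alpha> * real (block_start k))"
    by (rule mult_left_mono[OF block_end_le_alpha_mult]) simp
  also have "\<dots> = \<alpha> * (real k + 2)\<^sup>2 * real (block_start k)" by (simp add: mult_ac)
  finally show ?thesis using block_start_Suc_ge[of k] by linarith
qed

lemma block_end_less_Suc: "block_end k < block_start (Suc k)"
proof -
  have "1 * real (block_end k) < (real k + 2)\<^sup>2 * real (block_end k)"
    using block_start_pos[of k] block_start_le_end[of k]
    by (intro mult_strict_right_mono) (auto simp: power2_eq_square algebra_simps add_pos_nonneg)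
  then have "real (block_end k) < real (block_start (Suc k))"
    using square_mult_block_end_le[of k] by linarith
  then show ?thesis by (simp only: of_nat_less_iff)
qed

lemma strict_mono_block_start: "strict_mono block_start"
proof (rule strict_mono_Suc_iff[THEN iffD2], rule allI)
  show "block_start k < block_start (Suc k)" for k
    using block_start_le_end[of k] block_end_less_Suc[of k] by (rule le_less_trans)
qed

lemma less_block_start: "k < block_start k"
proof (induction k)
  case (Suc k)
  then show ?case using strict_monoD[OF strict_mono_block_start, of k "Suc k"] by simp
qed simp

lemma free_gap:
  assumes "block_end k \<le> i" "i < block_start (Suc k)"
  shows "free i"
  unfolding free_def
proof (intro allI notI)
  fix j assume j: "block_start j \<le> i \<and> i < block_end j"
  show False
  proof (cases "j \<le> k")
    case True
    have "block_end j \<le> block_end k"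
    proof (cases "j = k")
      case False
      then have "block_start (Suc j) \<le> block_start k"
        using True strict_mono_less_eq[OF strict_mono_block_start] by simp
      then show ?thesis using block_end_less_Suc[of j] block_start_le_end[of k] by linarith
    qed simp
    then show ?thesis using j assms by simp
  next
    case False
    then have "block_start (Suc k) \<le> block_start j"
      using strict_mono_less_eq[OF strict_mono_block_start] by simp
    then show ?thesis using j assms by simp
  qed
qed

lemma ex_block:
  assumes "block_start K \<le> t"
  obtains k where "K \<le> k" "block_start k \<le> t" "t < block_start (Suc k)"
proof -
  define k where "k = (LEAST k. t < block_start (Suc k))"
  have "t < block_start (Suc t)"
    using strict_mono_imp_increasing[OF strict_mono_block_start, of "Suc t"] by simp
  then have 1: "t < block_start (Suc k)" unfolding k_def by (rule LeastI)
  have 2: "block_start k \<le> t"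
  proof (cases k)
    case 0
    have "block_start 0 \<le> block_start K"
      using strict_mono_less_eq[OF strict_mono_block_start] by blast
    then show ?thesis using 0 assms by simp
  next
    case (Suc j)
    then have "\<not> t < block_start (Suc j)" unfolding k_def by (intro not_less_Least) simp
    then show ?thesis using Suc by simp
  qed
  have "block_start K < block_start (Suc k)" using assms 1 by simp
  then have "K \<le> k" using strict_mono_less[OF strict_mono_block_start] by simp
  with 1 2 show thesis using that by blast
qed

text \<open>Let \<open>n\<close> and \<open>m\<close> be the start and end of block
  \<open>k + 1\<close>; the critical case is \<open>t = m\<close>. There \<open>m / \<alpha>\<close>
  falls short of \<open>n\<close> by at least \<open>n / (\<alpha> * (k + 2))\<close>, hence by at
  least \<open>(k + 2) * block_start k\<close>, while discarding all positions before
  \<open>block_end k\<close> costs at most \<open>\<alpha> * block_start k\<close>. From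
  \<open>m\<close> to \<open>t\<close> every position is free.\<close>

lemma card_free_ge:
  assumes "block_start (Suc k) \<le> t" "t < block_start (Suc (Suc k))" "\<alpha> \<le> real k + 2"
  shows "real t / \<alpha> + (real k + 2 - \<alpha>) \<le> real (card {i. i < t \<and> free i})"
proof -
  \<comment> \<open>If \<open>t\<close> lies inside the block, \<open>?B\<close> is empty and
    \<open>t - ?m\<close> truncates to \<open>0\<close>, so one formula serves both cases.\<close>
  let ?n = "block_start (Suc k)" and ?m = "block_end (Suc k)"
  let ?A = "{block_end k..<?n}" and ?B = "{?m..<t}"
  have "?A \<union> ?B \<subseteq> {i. i < t \<and> free i}"
    using assms free_gap[of k] free_gap[of "Suc k"] by force
  then have "card (?A \<union> ?B) \<le> card {i. i < t \<and> free i}" by (intro card_mono) auto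
  moreover have "card (?A \<union> ?B) = (?n - block_end k) + (t - ?m)"
    using block_start_le_end[of "Suc k"] by (subst card_Un_disjoint) auto
  ultimately have card: "real ?n - real (block_end k) + real (t - ?m) \<le> real (card {i. i < t \<and> free i})"
    using block_end_less_Suc[of k] by linarith
  have k2: "0 < real k + 2" by simp
  have "(real k + 2 - \<alpha>) * 1 \<le> (real k + 2 - \<alpha>) * real (block_start k)"
    using block_start_pos[of k] assms by (intro mult_left_mono) auto
  also have "\<dots> = \<alpha> * (real k + 2)\<^sup>2 * real (block_start k) / (\<alpha> * (real k + 2)) - \<alpha> * real (block_start k)"
    using alpha_ge_2 k2 by (simp add: power2_eq_square left_diff_distrib)
  also have "\<dots> \<le> real ?n / (\<alpha> * (real k + 2)) - real (block_end k)"
    using block_start_Suc_ge[of k] block_end_le_alpha_mult[of k] alpha_ge_2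
    by (intro diff_mono divide_right_mono) auto
  finally have gain: "real k + 2 - \<alpha> \<le> real ?n / (\<alpha> * (real k + 2)) - real (block_end k)" by simp
  have "real ?m / \<alpha> \<le> (\<alpha> - 1 / (real k + 2)) * real ?n / \<alpha>"
    using block_end_le[of "Suc k"] alpha_ge_2 by (intro divide_right_mono) (auto simp: add_ac)
  also have "\<dots> = real ?n - real ?n / (\<alpha> * (real k + 2))"
    using alpha_ge_2 k2 by (simp add: left_diff_distrib diff_divide_distrib mult.commute[of \<alpha>])
  finally have m: "real ?m / \<alpha> \<le> real ?n - real ?n / (\<alpha> * (real k + 2))" .
  have "real t / \<alpha> \<le> real ?m / \<alpha> + real (t - ?m) / \<alpha>"
    using alpha_ge_2 by (simp add: field_simps)
  also have "\<dots> \<le> real ?m / \<alpha> + real (t - ?m)"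
    using alpha_ge_2 by (simp add: divide_le_eq mult_le_cancel_left1)
  finally show ?thesis using m gain card by linarith
qed

lemma eventually_card_free_ge:
  obtains T where "\<And>t. T \<le> t \<Longrightarrow> real t / \<alpha> + D \<le> real (card {i. i < t \<and> free i})"
proof -
  obtain K :: nat where K: "\<bar>D\<bar> + \<alpha> \<le> real K" using real_arch_simple by blast
  show thesis
  proof (rule that[of "block_start (Suc K)"])
    fix t assume "block_start (Suc K) \<le> t"
    then obtain k where k: "Suc K \<le> k" "block_start k \<le> t" "t < block_start (Suc k)"
      by (rule ex_block)
    then obtain j where j: "k = Suc j" by (cases k) auto
    have "real K \<le> real j" using j k by simp
    then show "real t / \<alpha> + D \<le> real (card {i. i < t \<and> free i})"
      using card_free_ge[of j t] k K alpha_ge_2 unfolding j by linarith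
  qed
qed

section \<open>Mass that the random point gives to sets of small diameter\<close>

lemma measurable_point [measurable]: "point \<in> borel_measurable coin_space"
  unfolding point_def [abs_def] cantor_point_def bits_def by measurable

lemma bits_eq_of_point_close:
  assumes "\<bar>point \<omega> - point \<omega>'\<bar> < 1 / 3 ^ t" "i < t" "free i"
  shows "\<omega> i = \<omega>' i"
  using eq_of_abs_diff_cantor_point_less[OF assms(1)[unfolded point_def] assms(2)] assms(3)
  by (simp add: bits_def)

lemma prob_point_in_le:
  assumes "bounded V" "diameter V < 1 / 3 ^ t"
  shows "measure coin_space {\<omega>. point \<omega> \<in> V} \<le> (1 / 2) ^ card {i. i < t \<and> free i}"
proof (rule prob_le_of_determined[where J\<^sub>1 = "{}"])
  fix \<omega> \<omega>' i
  assume "\<omega> \<in> {\<omega>. point \<omega> \<in> V}" "\<omega>' \<in> {\<omega>. point \<omega> \<in> V}" "i \<in> {i. i < t \<and> free i}"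
  moreover from this have "\<bar>point \<omega> - point \<omega>'\<bar> \<le> diameter V"
    using diameter_bounded_bound[OF assms(1), of "point \<omega>" "point \<omega>'"] by (simp add: dist_real_def)
  ultimately show "\<omega> i = \<omega>' i" using assms by (intro bits_eq_of_point_close) auto
qed auto

lemma half_power_eq_powr: "(1 / 2) ^ n = 2 powr (- real n)"
  by (simp add: powr_minus powr_realpow power_one_over inverse_eq_divide)

text \<open>Choose \<open>t\<close> with \<open>1 / 3 ^ Suc t \<le> diameter V < 1 / 3 ^ t\<close>.
  Since \<open>3 powr \<gamma> = 2\<close>, the target is at least
  \<open>2 powr (- ((t + 1) / \<alpha>))\<close>, and the surplus of free digits over
  \<open>t / \<alpha>\<close> absorbs \<open>N\<close>.\<close>

lemma point_mass_small:
  assumes \<gamma>: "\<gamma> = ln 2 / ln 3" and "0 < N"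
  shows "\<exists>\<delta>>0. \<forall>V. closed V \<longrightarrow> bounded V \<longrightarrow> diameter V \<le> \<delta> \<longrightarrow>
    N * measure coin_space {\<omega> \<in> space coin_space. point \<omega> \<in> V} \<le> diameter V powr (\<gamma> / \<alpha>)"
proof -
  \<comment> \<open>The logarithm cancels \<open>N\<close>; the extra \<open>1\<close> leaves a
    factor \<open>1 / 2\<close>, which pays for passing from \<open>t\<close> to
    \<open>t + 1\<close>.\<close>
  define D where "D = \<bar>log 2 N\<bar> + 1"
  obtain T where T: "\<And>t. T \<le> t \<Longrightarrow> real t / \<alpha> + D \<le> real (card {i. i < t \<and> free i})"
    using eventually_card_free_ge[of D] by blast
  have N: "N * 2 powr (- D) \<le> 1 / 2"
  proof -
    have "N * 2 powr (- D) = 2 powr (log 2 N - D)"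
      using \<open>0 < N\<close> by (simp add: powr_diff powr_minus divide_inverse)
    also have "\<dots> \<le> 2 powr (-1)" by (rule powr_mono) (auto simp: D_def)
    finally show ?thesis by (simp add: powr_minus)
  qed
  have bound: "N * measure coin_space {\<omega>. point \<omega> \<in> V} \<le> 2 powr (- ((real t + 1) / \<alpha>))"
    if "bounded V" "diameter V < 1 / 3 ^ t" "T \<le> t" for V t
  proof -
    have "measure coin_space {\<omega>. point \<omega> \<in> V} \<le> 2 powr (- (real t / \<alpha> + D))"
      using prob_point_in_le[OF that(1,2)] T[OF that(3)]
      by (auto simp: half_power_eq_powr elim: order_trans)
    then have "N * measure coin_space {\<omega>. point \<omega> \<in> V} \<le> N * 2 powr (- (real t / \<alpha> + D))"
      using \<open>0 < N\<close> by simp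
    also have "\<dots> = (N * 2 powr (- D)) * 2 powr (- (real t / \<alpha>))"
      by (simp add: mult.assoc algebra_simps flip: powr_add)
    also have "\<dots> \<le> 2 powr (-1) * 2 powr (- (real t / \<alpha>))"
      using N by (intro mult_right_mono) (auto simp: powr_minus)
    also have "\<dots> = 2 powr (-1 - real t / \<alpha>)" by (simp only: powr_add [symmetric]) simp
    also have "\<dots> \<le> 2 powr (- ((real t + 1) / \<alpha>))"
      using alpha_ge_2 by (intro powr_mono) (auto simp: field_simps)
    finally show ?thesis .
  qed
  show ?thesis
  proof (intro exI[of _ "1 / 3 ^ Suc T"] conjI allI impI)
    fix V :: "real set" assume V: "closed V" "bounded V" "diameter V \<le> 1 / 3 ^ Suc T"
    show "N * measure coin_space {\<omega> \<in> space coin_space. point \<omega> \<in> V} \<le> diameter V powr (\<gamma> / \<alpha>)"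
    proof (cases "diameter V = 0")
      case True
      \<comment> \<open>The right-hand side is now \<open>0\<close>, so the mass must vanish: the
        bound holds for all large \<open>t\<close> and tends to \<open>0\<close>.\<close>
      have "(\<lambda>t. 2 powr (- ((real t + 1) / \<alpha>))) \<longlonglongrightarrow> 0"
        using alpha_ge_2 by real_asymp
      then have "N * measure coin_space {\<omega>. point \<omega> \<in> V} \<le> 0"
        by (rule LIMSEQ_le_const) (use bound[OF V(2)] True in auto)
      then show ?thesis by (simp add: True)
    next
      case False
      then have d: "0 < diameter V" using diameter_ge_0[OF V(2)] by simp
      define t where "t = (LEAST t. 1 / 3 ^ Suc t \<le> diameter V)"
      obtain n where "(1 / 3) ^ n < diameter V" using real_arch_pow_inv[OF d, of "1/3"] by auto
      moreover have "(1 / 3 :: real) ^ Suc n \<le> (1/3) ^ n" by (rule power_decreasing) auto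
      ultimately have "1 / 3 ^ Suc n \<le> diameter V" by (simp add: power_divide)
      then have t1: "1 / 3 ^ Suc t \<le> diameter V" unfolding t_def by (rule LeastI)
      then have "1 / 3 ^ Suc t \<le> (1 / 3 ^ Suc T :: real)" using V(3) by linarith
      then have "(3::real) ^ Suc T \<le> 3 ^ Suc t" by (simp add: divide_simps del: power_Suc)
      then have "T \<le> t" by (subst (asm) power_increasing_iff) auto
      have t2: "diameter V < 1 / 3 ^ t"
      proof (cases t)
        case 0
        have "(1::real) < 3 ^ Suc T" by (rule one_less_power) auto
        then have "(1 / 3 ^ Suc T :: real) < 1" by (simp del: power_Suc)
        then have "diameter V < 1" using V(3) by linarith
        then show ?thesis using 0 by simp
      next
        case (Suc j)
        then have "\<not> 1 / 3 ^ Suc j \<le> diameter V" unfolding t_def by (intro not_less_Least) simp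
        then show ?thesis using Suc by simp
      qed
      have "2 powr (- ((real t + 1) / \<alpha>)) = (1 / 3 ^ Suc t) powr (\<gamma> / \<alpha>)"
      proof -
        have "(1 / 3 ^ Suc t :: real) = 3 powr (- real (Suc t))"
          by (simp only: powr_minus powr_realpow divide_inverse)
        then have "(1 / 3 ^ Suc t) powr (\<gamma> / \<alpha>) = exp (- (real t + 1) * (\<gamma> / \<alpha>) * ln 3)"
          by (simp add: powr_powr) (simp add: powr_def algebra_simps)
        also have "- (real t + 1) * (\<gamma> / \<alpha>) * ln 3 = - ((real t + 1) / \<alpha>) * (\<gamma> * ln 3)"
          using alpha_ge_2 by (simp add: field_simps)
        also have "\<gamma> * ln 3 = ln 2" by (simp add: \<gamma>)
        finally show ?thesis by (simp add: powr_def)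
      qed
      also have "\<dots> \<le> diameter V powr (\<gamma> / \<alpha>)"
        using t1 alpha_ge_2 by (intro powr_mono2) (auto simp: \<gamma>)
      finally show ?thesis using bound[OF V(2) t2 \<open>T \<le> t\<close>] by simp
    qed
  qed auto
qed

subsection \<open>Upper bound for the order\<close>

definition near :: "real \<Rightarrow> nat \<Rightarrow> (nat \<Rightarrow> bool) set" where
  "near \<tau> u = {\<omega>. \<exists>p::int. \<exists>q::nat. 3 ^ u \<le> q \<and> q < 3 ^ Suc u \<and>
     \<bar>point \<omega> - real_of_int p / real q\<bar> < real q powr - \<tau>}"

text \<open>Splits \<open>near\<close> by the exact power of \<open>3\<close> in the denominator.
  The cofactor \<open>q\<close> is invertible modulo powers of \<open>3\<close>, as the congruence
  argument requires.\<close>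

definition near_ord :: "real \<Rightarrow> nat \<Rightarrow> nat \<Rightarrow> (nat \<Rightarrow> bool) set" where
  "near_ord \<tau> u e = {\<omega>.
     \<exists>p::int. \<exists>q::nat. 3 ^ u \<le> 3 ^ e * q \<and> 3 ^ e * q < 3 ^ Suc u \<and> \<not> 3 dvd q \<and>
     \<bar>point \<omega> - real_of_int p / real (3 ^ e * q)\<bar> < real (3 ^ e * q) powr - \<tau>}"

lemma sets_near [measurable]: "near \<tau> u \<in> sets coin_space"
proof -
  have "near \<tau> u = {\<omega> \<in> space coin_space. \<exists>p::int. \<exists>q::nat. 3 ^ u \<le> q \<and> q < 3 ^ Suc u \<and>
     \<bar>point \<omega> - real_of_int p / real q\<bar> < real q powr - \<tau>}"
    by (simp add: near_def)
  also have "\<dots> \<in> sets coin_space" by measurable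
  finally show ?thesis .
qed

lemma sets_near_ord [measurable]: "near_ord \<tau> u e \<in> sets coin_space"
proof -
  have "near_ord \<tau> u e = {\<omega> \<in> space coin_space.
     \<exists>p::int. \<exists>q::nat. 3 ^ u \<le> 3 ^ e * q \<and> 3 ^ e * q < 3 ^ Suc u \<and> \<not> 3 dvd q \<and>
     \<bar>point \<omega> - real_of_int p / real (3 ^ e * q)\<bar> < real (3 ^ e * q) powr - \<tau>}"
    by (simp add: near_ord_def)
  also have "\<dots> \<in> sets coin_space" by measurable
  finally show ?thesis .
qed

lemma near_subset: "near \<tau> u \<subseteq> (\<Union>e\<le>u. near_ord \<tau> u e)"
proof
  fix \<omega> assume "\<omega> \<in> near \<tau> u"
  then obtain p q where pq: "3 ^ u \<le> q" "q < 3 ^ Suc u"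
     "\<bar>point \<omega> - real_of_int p / real q\<bar> < real q powr - \<tau>" unfolding near_def by blast
  have "0 < q" using pq(1) by (metis gr0I le_zero_eq power_not_zero zero_neq_numeral)
  then have "q \<noteq> 0" "\<not> is_unit (3::nat)" by auto
  then obtain e q' where q': "q = 3 ^ e * q'" "\<not> 3 dvd q'"
    by (metis multiplicity_decompose')
  have "3 ^ e \<le> q" using \<open>0 < q\<close> by (intro dvd_imp_le) (auto simp: q')
  then have "(3::nat) ^ e < 3 ^ Suc u" using pq(2) by linarith
  then have "e \<le> u" by (subst (asm) power_strict_increasing_iff) auto
  moreover have "\<omega> \<in> near_ord \<tau> u e"
    unfolding near_ord_def mem_Collect_eq
    by (intro exI[of _ p] exI[of _ q']) (use pq q' in simp)
  ultimately show "\<omega> \<in> (\<Union>e\<le>u. near_ord \<tau> u e)" by blast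
qed

lemma powr_minus_le_of_ge_power:
  assumes "0 \<le> \<tau>" "3 ^ u \<le> q"
  shows "real q powr - \<tau> \<le> 3 powr (- \<tau> * real u)"
proof -
  have "real (3 ^ u) \<le> real q" using assms(2) by (simp only: of_nat_le_iff)
  then have "real q powr - \<tau> \<le> (3 ^ u) powr - \<tau>"
    using assms(1) by (intro powr_mono2') auto
  also have "\<dots> = 3 powr (- \<tau> * real u)"
    by (simp add: powr_powr mult.commute flip: powr_realpow)
  finally show ?thesis .
qed

text \<open>Rationals with denominators near \<open>3 ^ u\<close> are \<open>9 ^ -u\<close> apart, so the first \<open>l\<close> digits determine
  which of them the point is close to, and this in turn determines the digits up to \<open>t\<close>.\<close>

lemma prob_near_le_of_free:
  assumes \<tau>: "3 \<le> (\<tau> - 2) * real u" "0 \<le> \<tau>" and l: "2 * u + 4 \<le> l"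
    and free: "\<And>i. l \<le> i \<Longrightarrow> i < t \<Longrightarrow> free i" and t: "real t \<le> \<tau> * real u - 1"
  shows "measure coin_space (near \<tau> u) \<le> (1 / 2) ^ (t - l)"
proof -
  have "measure coin_space (near \<tau> u) \<le> (1 / 2) ^ card {l..<t}"
  proof (rule prob_le_of_determined[where J\<^sub>1 = "{..<l}"])
    fix \<omega> \<omega>' i
    assume \<omega>: "\<omega> \<in> near \<tau> u" "\<omega>' \<in> near \<tau> u"
      and agree: "\<And>j. j \<in> {..<l} \<Longrightarrow> \<omega> j = \<omega>' j" and i: "i \<in> {l..<t}"
    \<comment> \<open>Distinct fractions of this size are at least \<open>c / 9\<close> apart, while
      the points are within \<open>c / 81\<close> of each other and within \<open>c / 27\<close> of
      their fractions; \<open>2 / 27 + 1 / 81 < 1 / 9\<close> explains the constants in the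
      hypotheses.\<close>
    define c :: real where "c = 1 / 9 ^ u"
    have c: "0 < c" by (simp add: c_def)
    define d where "d = 3 powr (- \<tau> * real u)"
    from \<omega>(1) obtain p q where pq: "3 ^ u \<le> q" "q < 3 ^ Suc u"
      "\<bar>point \<omega> - real_of_int p / real q\<bar> < real q powr - \<tau>" unfolding near_def by blast
    from \<omega>(2) obtain p' q' where pq': "3 ^ u \<le> q'" "q' < 3 ^ Suc u"
      "\<bar>point \<omega>' - real_of_int p' / real q'\<bar> < real q' powr - \<tau>" unfolding near_def by blast
    have close: "\<bar>point \<omega> - real_of_int p / real q\<bar> < d" "\<bar>point \<omega>' - real_of_int p' / real q'\<bar> < d"
      using powr_minus_le_of_ge_power[OF \<tau>(2) pq(1)] powr_minus_le_of_ge_power[OF \<tau>(2) pq'(1)] pq pq'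
      unfolding d_def by linarith+
    have qpos: "0 < q" "0 < q'"
      using pq(1) pq'(1) by (metis gr0I le_zero_eq power_not_zero zero_neq_numeral)+
    have "\<bar>point \<omega> - point \<omega>'\<bar> \<le> 1 / 3 ^ l"
      unfolding point_def using agree by (intro abs_diff_cantor_point_le) (auto simp: bits_def)
    also have "\<dots> \<le> 1 / 3 ^ (2 * u + 4)"
      using l by (intro divide_left_mono power_increasing) auto
    also have "\<dots> = c / 81" by (simp add: power_add power_mult c_def)
    finally have xx': "\<bar>point \<omega> - point \<omega>'\<bar> \<le> c / 81" .
    have "d \<le> 3 powr (- real (2 * u + 3))"
      unfolding d_def using \<tau>(1) by (intro powr_mono) (auto simp: algebra_simps)
    also have "\<dots> = 1 / 3 ^ (2 * u + 3)"
      by (simp only: powr_minus powr_realpow zero_less_numeral inverse_eq_divide)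
    also have "\<dots> = c / 27" by (simp add: power_add power_mult c_def)
    finally have d: "d \<le> c / 27" .
    have same: "real_of_int p / real q = real_of_int p' / real q'"
    proof (rule ccontr)
      assume "real_of_int p / real q \<noteq> real_of_int p' / real q'"
      then have "1 / (real q * real q') \<le> \<bar>real_of_int p / real q - real_of_int p' / real q'\<bar>"
        by (rule abs_diff_fractions_ge[OF qpos])
      moreover have "c / 9 \<le> 1 / (real q * real q')"
      proof -
        have "real q \<le> real (3 ^ Suc u)" "real q' \<le> real (3 ^ Suc u)"
          using pq(2) pq'(2) by (simp_all only: of_nat_le_iff less_imp_le)
        then have "real q * real q' \<le> real (3 ^ Suc u) * real (3 ^ Suc u)"
          by (intro mult_mono) auto
        also have "\<dots> = 9 ^ u * 9" by (simp flip: power_mult_distrib)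
        finally have "real q * real q' \<le> 9 ^ u * 9" .
        then have "1 / (9 ^ u * 9) \<le> 1 / (real q * real q')"
          using qpos by (intro divide_left_mono) auto
        then show ?thesis by (simp add: c_def)
      qed
      moreover have "\<bar>real_of_int p / real q - real_of_int p' / real q'\<bar> < d + d + c / 81"
        using close xx' by linarith
      ultimately show False using c d by linarith
    qed
    \<comment> \<open>Both points are now close to one fraction. Rounding \<open>2\<close> up to
      \<open>3\<close> accounts for the \<open>- 1\<close> in the bound on \<open>t\<close>.\<close>
    have "\<bar>point \<omega> - point \<omega>'\<bar> < 2 * d" using close same by linarith
    also have "\<dots> \<le> 3 powr 1 * d" by (simp add: d_def)
    also have "\<dots> = 3 powr (1 - \<tau> * real u)" unfolding d_def by (simp only: powr_add [symmetric]) simp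
    also have "\<dots> \<le> 3 powr (- real t)" using t by (intro powr_mono) auto
    also have "\<dots> = 1 / 3 ^ t"
      by (simp only: powr_minus powr_realpow zero_less_numeral inverse_eq_divide)
    finally have "\<bar>point \<omega> - point \<omega>'\<bar> < 1 / 3 ^ t" .
    then show "\<omega> i = \<omega>' i" using i free by (intro bits_eq_of_point_close) auto
  qed auto
  then show ?thesis by simp
qed

text \<open>Two approximations of one point, \<open>p / q\<close> and the truncation before the zero
  block, are compared after multiplying by \<open>q * 3 ^ block_start k\<close>. By
  \<open>gap\<close>, the truncation error then contributes at most \<open>1 / 2\<close>.\<close>

lemma near_remainder_le:
  assumes "1 \<le> \<tau>" "3 ^ u \<le> q" "q < 3 ^ Suc u"
    and close: "\<bar>point \<omega> - real_of_int p / real q\<bar> < real q powr - \<tau>"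
    and gap: "u + block_start k + 2 \<le> block_end k"
  shows "\<bar>real_of_int (p * 3 ^ block_start k - ternary_num (bits \<omega>) (block_start k) * int q)\<bar>
    \<le> 2 * 3 powr (real (block_start k) - (\<tau> - 1) * real u)"
proof -
  define n where "n = block_start k"
  define m where "m = block_end k"
  define P where "P = ternary_num (bits \<omega>) n"
  define r where "r = p * 3 ^ n - P * int q"
  define R where "R = 3 powr (real n - (\<tau> - 1) * real u)"
  have qpos: "0 < real q"
    using assms(2) by (metis gr0I le_zero_eq of_nat_0_less_iff power_not_zero zero_neq_numeral)
  have "\<bar>point \<omega> - real_of_int P / 3 ^ n\<bar> \<le> 1 / 3 ^ m"
    unfolding point_def P_def n_def m_def
    by (rule abs_cantor_point_diff_zeros) (auto simp: bits_def free_def block_start_le_end)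
  then have *: "\<bar>real_of_int p / real q - real_of_int P / 3 ^ n\<bar> < real q powr - \<tau> + 1 / 3 ^ m"
    using close by linarith
  have "real_of_int r = real q * 3 ^ n * (real_of_int p / real q - real_of_int P / 3 ^ n)"
    using qpos by (simp add: r_def field_simps)
  then have "\<bar>real_of_int r\<bar> = real q * 3 ^ n * \<bar>real_of_int p / real q - real_of_int P / 3 ^ n\<bar>"
    using qpos by (simp add: abs_mult)
  also have "\<dots> < real q * 3 ^ n * (real q powr - \<tau> + 1 / 3 ^ m)"
    using * qpos by (intro mult_strict_left_mono) auto
  also have "\<dots> = 3 ^ n * real q powr - (\<tau> - 1) + real q * 3 ^ n / 3 ^ m"
    using qpos by (simp add: distrib_left powr_diff powr_minus divide_simps)
  also have "\<dots> \<le> R + 1 / 2"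
  proof (rule add_mono)
    have "real q powr - (\<tau> - 1) \<le> 3 powr (- (\<tau> - 1) * real u)"
      using assms by (intro powr_minus_le_of_ge_power) auto
    then have "3 ^ n * real q powr - (\<tau> - 1) \<le> 3 powr real n * 3 powr (- (\<tau> - 1) * real u)"
      by (simp add: powr_realpow)
    also have "\<dots> = R" unfolding R_def by (simp only: powr_add [symmetric]) (simp add: algebra_simps)
    finally show "3 ^ n * real q powr - (\<tau> - 1) \<le> R" .
    have "real q \<le> real (3 ^ Suc u)" using assms(3) by (simp only: of_nat_le_iff less_imp_le)
    then have "real q * 3 ^ n \<le> 3 ^ Suc u * 3 ^ n" by (intro mult_right_mono) auto
    also have "\<dots> = 3 ^ (u + n + 2) / 3" by (simp add: power_add)
    also have "\<dots> \<le> 3 ^ m / 3"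
      using gap by (intro divide_right_mono power_increasing) (auto simp: n_def m_def)
    also have "\<dots> \<le> 1 / 2 * 3 ^ m" by simp
    finally show "real q * 3 ^ n / 3 ^ m \<le> 1 / 2" by (subst pos_divide_le_eq) auto
  qed
  finally have r: "\<bar>real_of_int r\<bar> < R + 1 / 2" .
  \<comment> \<open>Integrality removes the additive \<open>1 / 2\<close>: if
    \<open>R < 1 / 2\<close> then \<open>r = 0\<close>, and otherwise it only doubles
    \<open>R\<close>.\<close>
  have "\<bar>real_of_int r\<bar> \<le> 2 * R"
  proof (cases "R < 1 / 2")
    case True
    then have "r = 0" using r by linarith
    then show ?thesis by (simp add: R_def)
  next
    case False
    then show ?thesis using r by linarith
  qed
  then show ?thesis by (simp add: r_def R_def P_def n_def)
qed

text \<open>The remainder \<open>r = p 3 ^ n - P q\<close> is so small that \<open>P\<close> modulo a small power of \<open>3\<close> already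
  determines the fraction \<open>r / q\<close>, and hence \<open>P\<close> modulo \<open>3 ^ (n - e)\<close>.\<close>

lemma prob_near_ord_le:
  fixes k
  defines "n \<equiv> block_start (Suc k)"
  assumes \<tau>: "2 \<le> \<tau>" and e: "e \<le> u" and L: "u + L \<le> n" "real L \<le> (\<tau> - 2) * real u - 3"
    and gap: "u + n + 2 \<le> block_end (Suc k)"
  shows "measure coin_space (near_ord \<tau> u e) \<le> (1 / 2) ^ (L - block_end k)"
proof -
  \<comment> \<open>Positions \<open>e..<n\<close> correspond to \<open>P\<close> modulo
    \<open>3 ^ (n - e)\<close>. The last of them, \<open>e + L..<n\<close>, are taken as known, and
    the bits in \<open>J\<close> become determined.\<close>
  define J where "J = {i. e \<le> i \<and> i < e + L \<and> free i}"
  have "measure coin_space (near_ord \<tau> u e) \<le> (1 / 2) ^ card J"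
  proof (rule prob_le_of_determined[where J\<^sub>1 = "{e + L..<n}"])
    fix \<omega> \<omega>' i
    assume \<omega>: "\<omega> \<in> near_ord \<tau> u e" "\<omega>' \<in> near_ord \<tau> u e"
      and agree: "\<And>j. j \<in> {e + L..<n} \<Longrightarrow> \<omega> j = \<omega>' j" and i: "i \<in> J"
    define P where "P = ternary_num (bits \<omega>) n"
    define P' where "P' = ternary_num (bits \<omega>') n"
    define R where "R = 3 powr (real n - (\<tau> - 1) * real u - real e)"
    define Q where "Q = 3 powr (real u + 1 - real e)"
    have key: "\<exists>p q::int. 0 < q \<and> \<not> 3 dvd q \<and> real_of_int q \<le> Q \<and>
      \<bar>real_of_int (p * 3 ^ (n - e) - ternary_num (bits \<omega>) n * q)\<bar> \<le> 2 * R"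
      if "\<omega> \<in> near_ord \<tau> u e" for \<omega>
    proof -
      from that obtain p q where pq: "3 ^ u \<le> 3 ^ e * q" "3 ^ e * q < 3 ^ Suc u" "\<not> 3 dvd q"
        "\<bar>point \<omega> - real_of_int p / real (3 ^ e * q)\<bar> < real (3 ^ e * q) powr - \<tau>"
        unfolding near_ord_def by blast
      have rem: "\<bar>real_of_int (p * 3 ^ n - ternary_num (bits \<omega>) n * int (3 ^ e * q))\<bar>
          \<le> 2 * 3 powr (real n - (\<tau> - 1) * real u)"
        unfolding n_def using pq \<tau> gap by (intro near_remainder_le) (auto simp: n_def)
      have "p * 3 ^ n - ternary_num (bits \<omega>) n * int (3 ^ e * q)
          = 3 ^ e * (p * 3 ^ (n - e) - ternary_num (bits \<omega>) n * int q)"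
        using e L by (simp add: algebra_simps flip: power_add)
      then have "3 ^ e * \<bar>real_of_int (p * 3 ^ (n - e) - ternary_num (bits \<omega>) n * int q)\<bar>
          \<le> 2 * 3 powr (real n - (\<tau> - 1) * real u)"
        using rem by (simp only: of_int_mult abs_mult) simp
      also have "\<dots> = 3 ^ e * (2 * R)"
        unfolding R_def by (simp add: powr_diff powr_realpow)
      finally have "\<bar>real_of_int (p * 3 ^ (n - e) - ternary_num (bits \<omega>) n * int q)\<bar> \<le> 2 * R"
        by (subst (asm) mult_le_cancel_left_pos) auto
      moreover have "real q \<le> Q"
      proof -
        have "real (3 ^ e * q) \<le> real (3 ^ Suc u)" using pq(2) by (simp only: of_nat_le_iff less_imp_le)
        then have "3 ^ e * real q \<le> 3 powr (real u + 1)" by (simp add: powr_add powr_realpow)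
        also have "\<dots> = 3 ^ e * Q" unfolding Q_def by (simp add: powr_diff powr_realpow)
        finally show ?thesis by (subst (asm) mult_le_cancel_left_pos) auto
      qed
      moreover have "\<not> 3 dvd int q" using pq(3) by presburger
      moreover have "0 < int q" using pq(3) by (cases q) auto
      ultimately show ?thesis by (metis of_int_of_nat_eq)
    qed
    from key[OF \<omega>(1)] obtain p q where pq: "0 < q" "\<not> 3 dvd q" "real_of_int q \<le> Q"
      "\<bar>real_of_int (p * 3 ^ (n - e) - P * q)\<bar> \<le> 2 * R" unfolding P_def by blast
    from key[OF \<omega>(2)] obtain p' q' where pq': "0 < q'" "\<not> 3 dvd q'" "real_of_int q' \<le> Q"
      "\<bar>real_of_int (p' * 3 ^ (n - e) - P' * q')\<bar> \<le> 2 * R" unfolding P'_def by blast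
    \<comment> \<open>With reduced remainders \<open>r\<close> and \<open>r'\<close> this is
      \<open>r * q' - r' * q\<close>, which vanishes exactly when the fractions \<open>r / q\<close>
      and \<open>r' / q'\<close> agree. It is divisible by \<open>3 ^ (n - (e + L))\<close> and
      smaller than that; the \<open>- 3\<close> in the bound on \<open>L\<close> covers
      \<open>4 < 3 powr 2\<close> and the \<open>+ 1\<close> in \<open>Q\<close>.\<close>
    define D where "D = (p * 3 ^ (n - e) - P * q) * q' - (p' * 3 ^ (n - e) - P' * q') * q"
    have D_eq: "D = 3 ^ (n - e) * (p * q' - p' * q) - (P - P') * (q * q')"
      by (simp add: D_def algebra_simps)
    have eL: "e + L \<le> n" using e L by simp
    have "3 ^ (n - (e + L)) dvd ternary_num (bits \<omega>) (e + L + (n - (e + L))) -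
        ternary_num (bits \<omega>') (e + L + (n - (e + L)))"
      by (rule dvd_ternary_num_diff) (use agree in \<open>auto simp: bits_def\<close>)
    then have low: "3 ^ (n - (e + L)) dvd P - P'" using eL by (simp add: P_def P'_def)
    have "(3::int) ^ (n - (e + L)) dvd 3 ^ (n - e)" by (intro le_imp_power_dvd) auto
    then have dvdD: "3 ^ (n - (e + L)) dvd D"
      unfolding D_eq using low by (intro dvd_diff[OF dvd_mult2 dvd_mult2])
    have "\<bar>real_of_int D\<bar> \<le> \<bar>real_of_int ((p * 3 ^ (n - e) - P * q) * q')\<bar>
        + \<bar>real_of_int ((p' * 3 ^ (n - e) - P' * q') * q)\<bar>"
      unfolding D_def of_int_diff by (rule abs_triangle_ineq4)
    also have "\<dots> \<le> 2 * R * Q + 2 * R * Q"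
      unfolding of_int_mult abs_mult using pq pq' by (intro add_mono mult_mono) auto
    also have "\<dots> = 4 * 3 powr (real n - (\<tau> - 2) * real u - 2 * real e + 1)"
      unfolding R_def Q_def by (simp flip: powr_add) (simp add: algebra_simps)
    also have "\<dots> < 3 powr 2 * 3 powr (real n - (\<tau> - 2) * real u - 2 * real e + 1)"
      by simp
    also have "\<dots> = 3 powr (real n - (\<tau> - 2) * real u - 2 * real e + 3)"
      by (simp only: powr_add [symmetric]) (simp add: algebra_simps)
    also have "\<dots> \<le> 3 powr real (n - (e + L))"
      using L eL by (intro powr_mono) (auto simp: of_nat_diff)
    also have "\<dots> = real_of_int (3 ^ (n - (e + L)))" by (simp add: powr_realpow)
    finally have "\<bar>D\<bar> < 3 ^ (n - (e + L))" by (simp only: of_int_abs [symmetric] of_int_less_iff)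
    then have "D = 0" using dvdD zdvd_not_zless[of "\<bar>D\<bar>" "3 ^ (n - (e + L))"] by auto
    \<comment> \<open>With \<open>D = 0\<close> the congruence holds modulo the larger power
      \<open>3 ^ (n - e)\<close>, and cancelling \<open>q * q'\<close> gains \<open>L\<close>
      further digits.\<close>
    then have "3 ^ (n - e) dvd (P - P') * (q * q')"
      unfolding D_eq by (metis dvd_triv_left eq_iff_diff_eq_0)
    moreover have "coprime (3 ^ (n - e)) (q * q')"
      using pq(2) pq'(2) by (simp add: prime_imp_coprime)
    ultimately have "3 ^ (n - e) dvd P - P'" by (simp add: coprime_dvd_mult_left_iff)
    then have "3 ^ (n - e) dvd ternary_num (bits \<omega>) (e + (n - e)) - ternary_num (bits \<omega>') (e + (n - e))"
      using eL by (simp add: P_def P'_def)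
    then have "bits \<omega> i = bits \<omega>' i"
      by (rule eq_of_dvd_ternary_num_diff) (use i eL in \<open>auto simp: J_def\<close>)
    then show "\<omega> i = \<omega>' i" using i by (simp add: bits_def J_def)
  qed (auto simp: J_def)
  also have "\<dots> \<le> (1 / 2) ^ (L - block_end k)"
  proof (rule power_decreasing)
    \<comment> \<open>Positions from \<open>block_end k\<close> up to \<open>n\<close> are free, so
      at most \<open>block_end k\<close> of the \<open>L\<close> positions are lost.\<close>
    have "{max e (block_end k)..<e + L} \<subseteq> J"
      using e L free_gap[of k] by (auto simp: J_def n_def)
    then have "card {max e (block_end k)..<e + L} \<le> card J" by (intro card_mono) (auto simp: J_def)
    then show "L - block_end k \<le> card J" by simp
  qed auto
  finally show ?thesis .
qed

text \<open>Let \<open>k\<close> be the last block starting by \<open>s\<close>, about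
  \<open>(1 + \<eta>) * u\<close>. If block \<open>k + 1\<close> does not start before
  \<open>t\<close>, about \<open>\<tau> * u\<close>, the digits after block \<open>k\<close> are
  free up to \<open>t\<close> and spacing applies. Otherwise that block starts between these scales,
  and \<open>prob_near_ord_le\<close> is summed over the \<open>u + 1\<close> values of
  \<open>e\<close>.\<close>

lemma prob_near_le:
  assumes "\<alpha> < \<tau>"
  obtains U where "\<And>u. U \<le> u \<Longrightarrow>
    measure coin_space (near \<tau> u) \<le> (real u + 1) * 2 powr (1 - (\<tau> - \<alpha>) / (4 * \<alpha>) * real u)"
proof -
  \<comment> \<open>Makes \<open>\<alpha> * (1 + \<eta>)\<close> the midpoint of \<alpha> and
    \<tau>, so block \<open>k\<close> ends well before \<open>\<tau> * u\<close>.\<close>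
  define \<eta> where "\<eta> = (\<tau> - \<alpha>) / (2 * \<alpha>)"
  have \<eta>: "0 < \<eta>" "\<tau> - \<alpha> = 2 * \<alpha> * \<eta>"
    using assms alpha_ge_2 by (auto simp: \<eta>_def)
  have \<tau>\<eta>: "4 * \<eta> \<le> \<tau> - \<alpha>"
    unfolding \<eta>(2) using \<eta>(1) alpha_ge_2 by simp
  \<comment> \<open>The first bound makes \<open>block_end k\<close> at most
    \<open>\<eta> * u / 2\<close> in the second case; the second makes \<open>n / (k + 2)\<close> at
    most half of \<open>n - n / (1 + \<eta>)\<close>. The bound \<open>10 / \<eta>\<close> on
    \<open>u\<close> absorbs additive constants.\<close>
  obtain K :: nat where K: "max (2 * \<tau> / \<eta>) (2 * (1 + \<eta>) / \<eta>) \<le> real K" using real_arch_simple by blast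
  obtain U :: nat where U: "max (real (block_start K)) (10 / \<eta>) \<le> real U" using real_arch_simple by blast
  show thesis
  proof (rule that[of U])
    fix u assume "U \<le> u"
    then have u: "block_start K \<le> u" "10 / \<eta> \<le> real u" using U by auto
    have \<eta>u: "10 \<le> \<eta> * real u" using u(2) \<eta>(1) by (simp add: divide_le_eq mult.commute)
    have diff_u: "40 \<le> (\<tau> - \<alpha>) * real u" "4 * (\<eta> * real u) \<le> (\<tau> - \<alpha>) * real u"
      using mult_right_mono[OF \<tau>\<eta>, of "real u"] \<eta>u by auto
    have two_u: "(\<tau> - \<alpha>) * real u \<le> (\<tau> - 2) * real u"
      using alpha_ge_2 by (intro mult_right_mono) auto
    define s where "s = nat \<lfloor>(1 + \<eta>) * real u\<rfloor>"
    have s: "real s \<le> (1 + \<eta>) * real u" "(1 + \<eta>) * real u < real s + 1"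
      unfolding s_def using \<eta>(1) by (auto intro!: of_nat_floor)
    have "real u \<le> (1 + \<eta>) * real u" using \<eta>(1) by (simp add: distrib_right)
    then have "real u < real (Suc s)" using s(2) by simp
    then have "block_start K \<le> s" using u(1) by (simp only: of_nat_less_iff)
    then obtain k where k: "K \<le> k" "block_start k \<le> s" "s < block_start (Suc k)"
      by (rule ex_block)
    have kK: "2 * \<tau> / \<eta> \<le> real k + 2" "2 * (1 + \<eta>) / \<eta> \<le> real k + 2"
      using K k(1) by (auto simp: of_nat_mono intro: order_trans)
    have half: "(\<tau> - \<alpha>) / (4 * \<alpha>) = \<eta> / 2" by (simp add: \<eta>_def)
    have goal_of_exponent: "(1 / 2) ^ N \<le> 2 powr (1 - (\<tau> - \<alpha>) / (4 * \<alpha>) * real u)"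
      if "\<eta> * real u / 2 - 1 \<le> real N" for N :: nat
      unfolding half_power_eq_powr half using that by (intro powr_mono) auto
    define t where "t = nat \<lfloor>\<tau> * real u - 1\<rfloor>"
    have "0 \<le> \<alpha> * real u" using alpha_ge_2 by simp
    then have "1 \<le> \<tau> * real u" using diff_u(1) by (simp add: left_diff_distrib)
    then have t: "real t \<le> \<tau> * real u - 1" "\<tau> * real u - 2 < real t"
      unfolding t_def by linarith+
    define n where "n = block_start (Suc k)"
    show "measure coin_space (near \<tau> u) \<le> (real u + 1) * 2 powr (1 - (\<tau> - \<alpha>) / (4 * \<alpha>) * real u)"
    proof (cases "t \<le> n")
      case True
      define l where "l = max (2 * u + 4) (block_end k)"
      have "measure coin_space (near \<tau> u) \<le> (1 / 2) ^ (t - l)"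
      proof (rule prob_near_le_of_free)
        show "free i" if "l \<le> i" "i < t" for i
          using that True by (intro free_gap[of k]) (auto simp: l_def n_def)
      qed (use diff_u two_u t assms alpha_ge_2 in \<open>auto simp: l_def\<close>)
      also have "\<dots> \<le> 2 powr (1 - (\<tau> - \<alpha>) / (4 * \<alpha>) * real u)"
      proof (rule goal_of_exponent)
        have "real (block_end k) \<le> \<alpha> * ((1 + \<eta>) * real u)"
        proof -
          have "real (block_start k) \<le> (1 + \<eta>) * real u" using k(2) s(1) by linarith
          then have "\<alpha> * real (block_start k) \<le> \<alpha> * ((1 + \<eta>) * real u)"
            using alpha_ge_2 by (intro mult_left_mono) auto
          then show ?thesis using block_end_le_alpha_mult[of k] by linarith
        qed
        also have "\<dots> = \<tau> * real u - (\<tau> - \<alpha>) * real u / 2"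
          using \<eta>(2) by (simp add: algebra_simps)
        finally have "real (block_end k) \<le> \<tau> * real u - (\<tau> - \<alpha>) * real u / 2" .
        then have "real l \<le> \<tau> * real u - (\<tau> - \<alpha>) * real u / 2 + 4"
          using two_u diff_u(1) unfolding l_def of_nat_max
          by (intro max.boundedI) (auto simp: left_diff_distrib diff_divide_distrib)
        then show "\<eta> * real u / 2 - 1 \<le> real (t - l)"
          using t(2) diff_u by linarith
      qed
      also have "\<dots> \<le> (real u + 1) * 2 powr (1 - (\<tau> - \<alpha>) / (4 * \<alpha>) * real u)"
        by (simp add: mult_le_cancel_right1)
      finally show ?thesis .
    next
      case False
      define L where "L = nat \<lfloor>\<eta> * real u\<rfloor>"
      have L: "real L \<le> \<eta> * real u" "\<eta> * real u - 1 < real L"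
        unfolding L_def using \<eta>u by linarith+
      have n: "(1 + \<eta>) * real u < real n" using s k(3) by (simp add: n_def)
      have end_small: "real (block_end k) \<le> \<eta> * real u / 2"
      proof -
        have "2 * \<tau> / \<eta> * real (block_end k) \<le> (real k + 2) * real (block_end k)"
          using kK(1) by (intro mult_right_mono) auto
        also have "\<dots> \<le> (real k + 2)\<^sup>2 * real (block_end k)"
          by (intro mult_right_mono) (auto simp: power2_eq_square)
        also have "\<dots> \<le> real n" unfolding n_def by (rule square_mult_block_end_le)
        also have "\<dots> \<le> \<tau> * real u" using False t(1) by linarith
        finally have "\<tau> * (2 / \<eta> * real (block_end k)) \<le> \<tau> * real u" by (simp add: mult_ac)
        then have "2 / \<eta> * real (block_end k) \<le> real u"
          using assms alpha_ge_2 by (subst (asm) mult_le_cancel_left_pos) auto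
        then show ?thesis using \<eta>(1) by (simp add: field_simps)
      qed
      \<comment> \<open>As \<alpha> is at least \<open>2\<close>, it suffices that
        \<open>u + n / (k + 2) + 3 \<le> n\<close>. The room \<open>n - n / (1 + \<eta>)\<close>
        above \<open>u\<close> is at least \<open>10\<close>: half of it covers
        \<open>n / (k + 2)\<close>, the other half the constant.\<close>
      have gap: "u + n + 2 \<le> block_end (Suc k)"
      proof -
        have "real n / (real k + 2) \<le> real n / (2 * (1 + \<eta>) / \<eta>)"
          using kK(2) \<eta>(1) by (intro divide_left_mono) auto
        also have "\<dots> = real n * \<eta> / (1 + \<eta>) / 2" by simp
        finally have 1: "real n / (real k + 2) \<le> real n * \<eta> / (1 + \<eta>) / 2" .
        have 2: "real u \<le> real n / (1 + \<eta>)" using n \<eta>(1) by (simp add: pos_le_divide_eq mult.commute)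
        have "real u * \<eta> \<le> real n / (1 + \<eta>) * \<eta>" using 2 \<eta>(1) by (intro mult_right_mono) auto
        then have 3: "10 \<le> real n * \<eta> / (1 + \<eta>)" using \<eta>u by (simp add: mult.commute)
        have "real n = real n * (1 + \<eta>) / (1 + \<eta>)" using \<eta>(1) by simp
        also have "\<dots> = real n / (1 + \<eta>) + real n * \<eta> / (1 + \<eta>)"
          by (simp only: distrib_left add_divide_distrib mult_1_right)
        finally have 4: "real n = real n / (1 + \<eta>) + real n * \<eta> / (1 + \<eta>)" .
        have 5: "real u + real n / (real k + 2) + 3 \<le> real n"
        proof -
          have "a + b + 3 \<le> d" if "b \<le> x / 2" "a \<le> y" "10 \<le> x" "d = y + x" for a b d x y :: real
            using that by simp
          from this[OF 1 2 3 4] show ?thesis .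
        qed
        have "2 * real n - real n / (real k + 2) \<le> (\<alpha> - 1 / (real k + 2)) * real n"
          using mult_right_mono[OF alpha_ge_2, of "real n"] by (simp add: left_diff_distrib)
        also have "\<dots> < real (block_end (Suc k)) + 1"
          using block_end_gt[of "Suc k"] by (simp add: n_def add_ac)
        finally have "real (u + n + 2) \<le> real (block_end (Suc k))" using 5 by simp
        then show ?thesis by (simp only: of_nat_le_iff)
      qed
      have each: "measure coin_space (near_ord \<tau> u e) \<le> 2 powr (1 - (\<tau> - \<alpha>) / (4 * \<alpha>) * real u)"
        if "e \<le> u" for e
      proof -
        have "measure coin_space (near_ord \<tau> u e) \<le> (1 / 2) ^ (L - block_end k)"
        proof (rule prob_near_ord_le[OF _ that])
          have "real (u + L) \<le> real n" using n L(1) by (simp add: distrib_right)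
          then show "u + L \<le> block_start (Suc k)" by (simp only: of_nat_le_iff n_def)
          show "real L \<le> (\<tau> - 2) * real u - 3" using L(1) diff_u two_u \<eta>u by linarith
        qed (use assms alpha_ge_2 gap in \<open>auto simp: n_def\<close>)
        also have "\<dots> \<le> 2 powr (1 - (\<tau> - \<alpha>) / (4 * \<alpha>) * real u)"
          by (rule goal_of_exponent) (use L(2) end_small in linarith)
        finally show ?thesis .
      qed
      interpret prob_space coin_space by (rule prob_space_coin_space)
      have "measure coin_space (near \<tau> u) \<le> measure coin_space (\<Union>e\<le>u. near_ord \<tau> u e)"
        by (rule finite_measure_mono[OF near_subset]) auto
      also have "\<dots> \<le> (\<Sum>e\<le>u. measure coin_space (near_ord \<tau> u e))"
        by (rule finite_measure_subadditive_finite) auto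
      also have "\<dots> \<le> (\<Sum>e\<le>u. 2 powr (1 - (\<tau> - \<alpha>) / (4 * \<alpha>) * real u))"
        by (intro sum_mono each) simp
      finally show ?thesis by (simp add: add.commute)
    qed
  qed
qed

text \<open>Borel-Cantelli: the bounds sum like a differentiated geometric series, so almost surely
  only finitely many scales \<open>u\<close> are hit, whereas membership in \<open>W \<tau>\<close>
  produces arbitrarily large ones.\<close>

lemma AE_not_in_W:
  assumes "\<alpha> < \<tau>"
  shows "AE \<omega> in coin_space. point \<omega> \<notin> W \<tau>"
proof -
  interpret prob_space coin_space by (rule prob_space_coin_space)
  obtain U where U: "\<And>u. U \<le> u \<Longrightarrow>
    measure coin_space (near \<tau> u) \<le> (real u + 1) * 2 powr (1 - (\<tau> - \<alpha>) / (4 * \<alpha>) * real u)"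
    using prob_near_le[OF assms] by blast
  define z where "z = 2 powr - ((\<tau> - \<alpha>) / (4 * \<alpha>))"
  have z: "norm z < 1" using assms alpha_ge_2 by (simp add: z_def powr_less_one)
  have "summable (\<lambda>u. 2 * (real (Suc u) * z ^ u))"
    by (intro summable_mult sums_summable[OF geometric_deriv_sums[OF z]])
  moreover have "2 * (real (Suc u) * z ^ u) = (real u + 1) * 2 powr (1 - (\<tau> - \<alpha>) / (4 * \<alpha>) * real u)" for u
  proof -
    have "z ^ u = 2 powr (- ((\<tau> - \<alpha>) / (4 * \<alpha>)) * real u)"
      unfolding z_def by (simp add: powr_powr flip: powr_realpow)
    moreover have "2 powr (1 - x) = 2 * 2 powr (- x)" for x :: real
      by (simp add: powr_diff powr_minus divide_inverse)
    ultimately show ?thesis by (simp add: add.commute)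
  qed
  ultimately have "summable (\<lambda>u. (real u + 1) * 2 powr (1 - (\<tau> - \<alpha>) / (4 * \<alpha>) * real u))"
    by (simp only:)
  then have "summable (\<lambda>u. measure coin_space (near \<tau> u))"
    by (rule summable_comparison_test'[where N = U]) (use U in simp)
  then have "AE \<omega> in coin_space. eventually (\<lambda>u. \<omega> \<in> space coin_space - near \<tau> u) sequentially"
    by (intro borel_cantelli_AE1) (auto simp: less_top[symmetric])
  then show ?thesis
  proof eventually_elim
    case (elim \<omega>)
    then obtain V where V: "\<And>u. V \<le> u \<Longrightarrow> \<omega> \<notin> near \<tau> u"
      by (auto simp: eventually_sequentially)
    show ?case
    proof
      assume "point \<omega> \<in> W \<tau>"
      moreover have "0 < \<tau>" using assms alpha_ge_2 by simp
      ultimately obtain u q p where "V \<le> u" "3 ^ u \<le> q" "q < 3 ^ Suc u"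
        "\<bar>point \<omega> - real_of_int p / real q\<bar> < real q powr - \<tau>"
        by (rule mem_W_imp_large_denominator)
      then show False using V[of u] unfolding near_def by blast
    qed
  qed
qed

subsection \<open>The exact order\<close>

text \<open>This holds for every \<omega>: truncation before each long block gives a good fraction,
  and distinct blocks give distinct denominators.\<close>

lemma point_in_W:
  assumes "0 < \<tau>" "\<tau> < \<alpha>"
  shows "point \<omega> \<in> W \<tau>"
proof -
  \<comment> \<open>Makes the slack \<open>1 / (k + 1)\<close> at most half of
    \<open>\<alpha> - \<tau>\<close>; the other half, times \<open>block_start k\<close>, is at
    least \<open>1\<close> and pays for the floor in \<open>block_end\<close>.\<close>
  obtain K :: nat where K: "2 / (\<alpha> - \<tau>) \<le> real K" using real_arch_simple by blast
  define f where "f k = (ternary_num (bits \<omega>) (block_start k), (3::nat) ^ block_start k)" for k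
  have "inj_on f {K..}"
    by (rule inj_onI) (auto simp: f_def strict_mono_eq[OF strict_mono_block_start])
  then have inf: "infinite (f ` {K..})"
    using finite_imageD infinite_Ici by blast
  have "f k \<in> {(p, q). 0 < q \<and> \<bar>point \<omega> - real_of_int p / real q\<bar> < real q powr - \<tau>}" if "K \<le> k" for k
  proof -
    let ?n = "block_start k" and ?m = "block_end k"
    have "k < ?n" by (rule less_block_start)
    have "2 / (\<alpha> - \<tau>) \<le> real k + 1" using K that by linarith
    then have gap: "2 \<le> (\<alpha> - \<tau>) * (real k + 1)"
      using assms by (simp add: pos_divide_le_eq mult.commute)
    have "(\<alpha> - \<tau>) * (real k + 1) \<le> (\<alpha> - \<tau>) * real ?n"
      using \<open>k < ?n\<close> assms by (intro mult_left_mono) auto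
    with gap have "2 \<le> (\<alpha> - \<tau>) * real ?n" by linarith
    moreover have "1 / (real k + 1) * real ?n \<le> (\<alpha> - \<tau>) / 2 * real ?n"
      using gap by (intro mult_right_mono) (auto simp: field_simps)
    ultimately have m: "\<tau> * real ?n < real ?m"
      using block_end_gt[of k] by (simp add: left_diff_distrib)
    have "\<bar>point \<omega> - real_of_int (ternary_num (bits \<omega>) ?n) / 3 ^ ?n\<bar> \<le> 1 / 3 ^ ?m"
      unfolding point_def
      by (rule abs_cantor_point_diff_zeros) (auto simp: bits_def free_def block_start_le_end)
    also have "\<dots> = 3 powr - real ?m"
      by (simp only: powr_minus powr_realpow zero_less_numeral inverse_eq_divide)
    also have "\<dots> < 3 powr (- (\<tau> * real ?n))" using m by (intro powr_less_mono) auto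
    also have "\<dots> = real (3 ^ ?n) powr - \<tau>"
      by (simp add: powr_powr mult.commute flip: powr_realpow)
    finally show ?thesis by (simp add: f_def)
  qed
  then have "f ` {K..} \<subseteq> {(p, q). 0 < q \<and> \<bar>point \<omega> - real_of_int p / real q\<bar> < real q powr - \<tau>}"
    by (intro image_subsetI) simp
  then show ?thesis
    unfolding W_def mem_Collect_eq using inf by (rule infinite_super)
qed

text \<open>\<open>W \<tau>\<close> shrinks as \<tau> grows, so excluding the countably many orders
  \<open>\<alpha> + 1 / Suc j\<close> almost surely excludes every order above \<alpha>.\<close>

lemma AE_point_in_E: "AE \<omega> in coin_space. point \<omega> \<in> E \<alpha> \<inter> cantor_set"
proof -
  have "AE \<omega> in coin_space. \<forall>j::nat. point \<omega> \<notin> W (\<alpha> + 1 / real (Suc j))"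
    by (subst AE_all_countable) (auto intro: AE_not_in_W)
  then show ?thesis
  proof eventually_elim
    case (elim \<omega>)
    have upper: "\<tau> \<le> \<alpha>" if "0 < \<tau>" "point \<omega> \<in> W \<tau>" for \<tau>
    proof (rule ccontr)
      assume "\<not> \<tau> \<le> \<alpha>"
      then obtain j where j: "1 / real (Suc j) < \<tau> - \<alpha>"
        using reals_Archimedean[of "\<tau> - \<alpha>"] by (auto simp: inverse_eq_divide)
      have mono: "real q powr - \<tau> \<le> real q powr - (\<alpha> + 1 / real (Suc j))" if "0 < q" for q :: nat
        using that j by (intro powr_mono) auto
      have "{(p :: int, q :: nat). 0 < q \<and> \<bar>point \<omega> - real_of_int p / real q\<bar> < real q powr (- \<tau>)}
         \<subseteq> {(p, q). 0 < q \<and> \<bar>point \<omega> - real_of_int p / real q\<bar> < real q powr - (\<alpha> + 1 / real (Suc j))}"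
        using mono by (force intro: less_le_trans)
      then have "point \<omega> \<in> W (\<alpha> + 1 / real (Suc j))"
        using that(2) finite_subset unfolding W_def mem_Collect_eq by blast
      with elim show False by blast
    qed
    have "exact_order (point \<omega>) = ereal \<alpha>"
      unfolding exact_order_def
    proof (rule antisym)
      show "Sup {ereal \<tau> |\<tau>. 0 < \<tau> \<and> point \<omega> \<in> W \<tau>} \<le> ereal \<alpha>"
        by (rule Sup_least) (auto intro: upper)
      show "ereal \<alpha> \<le> Sup {ereal \<tau> |\<tau>. 0 < \<tau> \<and> point \<omega> \<in> W \<tau>}"
      proof (rule le_Sup_iff[THEN iffD2], intro allI impI)
        fix y assume "y < ereal \<alpha>"
        \<comment> \<open>The supremum runs over positive \<tau>, hence the maximum with
          \<open>0\<close>.\<close>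
        then have "max y 0 < ereal \<alpha>" using alpha_ge_2 by simp
        then obtain \<tau> where \<tau>: "max y 0 < ereal \<tau>" "ereal \<tau> < ereal \<alpha>"
          using ereal_dense2 by blast
        then have "0 < \<tau>" "\<tau> < \<alpha>" by simp_all
        then show "\<exists>a\<in>{ereal \<tau> |\<tau>. 0 < \<tau> \<and> point \<omega> \<in> W \<tau>}. y < a"
          using point_in_W[of \<tau> \<omega>] \<tau> by auto
      qed
    qed
    then show ?case by (simp add: E_def point_def cantor_point_in_cantor_set)
  qed
qed

lemma hausdorff_measure_E:
  assumes "\<gamma> = ln 2 / ln 3"
  shows "hausdorff_measure (\<gamma> / \<alpha>) (E \<alpha> \<inter> cantor_set) = \<infinity>"
  using alpha_ge_2 assms
  by (intro hausdorff_measure_eq_top_of_mass[OF prob_space_coin_space measurable_point _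
      AE_point_in_E point_mass_small[OF assms]]) auto

end

theorem corollary2:
  fixes \<gamma> :: real
  assumes "\<gamma> = ln 2 / ln 3"
  shows "(\<forall>\<alpha>::real. \<alpha> \<ge> 2 \<longrightarrow> hausdorff_dim (E \<alpha> \<inter> cantor_set) \<ge> ereal (\<gamma> / \<alpha>)) \<and>
         (\<forall>\<alpha>::real. \<alpha> > 2 \<longrightarrow> hausdorff_measure (\<gamma> / \<alpha>) (E \<alpha> \<inter> cantor_set) = \<infinity>)"
proof -
  \<comment> \<open>The construction covers \<open>\<alpha> = 2\<close>, so infinite measure yields
    the dimension bound there as well.\<close>
  have inf: "hausdorff_measure (\<gamma> / \<alpha>) (E \<alpha> \<inter> cantor_set) = \<infinity>" if "2 \<le> \<alpha>" for \<alpha>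
  proof -
    interpret zero_blocks \<alpha> by unfold_locales (fact that)
    show ?thesis using assms by (rule hausdorff_measure_E)
  qed
  then have "ereal (\<gamma> / \<alpha>) \<le> hausdorff_dim (E \<alpha> \<inter> cantor_set)" if "2 \<le> \<alpha>" for \<alpha>
    using that assms by (intro hausdorff_dim_ge) auto
  with inf show ?thesis by simp
qed

end
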